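(* Let $R$ be a commutative semiring and let $(\mathbf H,\oplus,0,\otimes,1,\mathrm{scal})$ be a semiadditive category $(\mathbf H,\oplus,0)$ with a symmetric monoidal structure $(\otimes,1)$ distributive over it, and with a semiring isomorphism $\mathrm{scal}:R\to\mathbf H(1,1)$. Let $\mathbf{TP}^R$ be the coloured PROP of (full) Tensor-Plus diagrams over $R$, and $[\![-]\!]^{\oplus 1}$ its semantics in the category $\mathbf H^{\oplus 1}$. Then for all objects $\mathcal X,\mathcal Y$ of $\mathbf{TP}^R$ and every morphism $f\in\mathbf H^{\oplus 1}([\![\mathcal X]\!],[\![\mathcal Y]\!])$, there exists a diagram $d\in\mathbf{TP}^R(\mathcal X,\mathcal Y)$ such that $[\![d]\!]^{\oplus 1}=f$.
   Context: **Target category.** $(\mathbf H,\oplus,0)$ is semiadditive: it has finite biproducts $\oplus$ with zero object $0$, injections $\iota_\ell,\iota_r$, projections $\pi_\ell,\pi_r$, diagonal $\Delta:H\to H\oplus H$, codiagonal $\nabla:H\oplus H\to H$, zero morphisms $\mathbf{zero}$, and the induced commutative-monoid enrichment $f+g=\nabla\circ(f\oplus g)\circ\Delta$. $(\mathbf H,\otimes,1)$ is symmetric monoidal and distributive over $\oplus$: the canonical maps $H\otimes(K\oplus L)\to(H\otimes K)\oplus(H\otimes L)$ and $H\otimes 0\to 0$ are isomorphisms. The hom-set $\mathbf H(1,1)$ is a commutative semiring under $+,\mathbf{zero},\circ,\mathrm{id}$. For $s\in R$ and $f:H\to K$, put $s\cdot f:=\lambda^\otimes\circ(\mathrm{scal}(s)\otimes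 f)\circ(\lambda^\otimes)^{-1}$, where $\lambda^\otimes:1\otimes H\to H$ is the left unitor. **The product $|$.** $H\mid K:=(H\otimes K)\oplus(H\oplus K)$ and $f\mid g:=(f\otimes g)\oplus(f\oplus g)$. This is a symmetric monoidal product with unit $0$. Its unitors $0\mid H\to H$ and $H\mid 0\to H$ are the projections onto the summand $H$. Its symmetry is $\sigma^|=\sigma^\otimes\oplus\sigma^\oplus$. Its associator $(H\mid K)\mid L\to H\mid(K\mid L)$ is obtained by expanding both sides by distributivity into seven summands, $H\otimes K\otimes L$ (suitably bracketed), $H\otimes K$, $H\otimes L$, $K\otimes L$, $H$, $K$, $L$, and matching corresponding summands by $\alpha^\otimes$ on the triple tensor and identities elsewhere. $m^|$ (resp. $m^\oplus$) denotes the unique canonical isomorphism between two bracketings (with units) for $|$ (resp. $\oplus$). **The category $\mathbf H^{\oplus 1}$.** It has the same objects as $\mathbf H$, and $\mathbf H^{\oplus 1}(H,K)$ is the set of morphisms of $\mathbf H(H\oplus 1,K\oplus 1)$ of the form $g+(\iota_r\circ\pi_r)$ for some $g\in\mathbf H(H\oplus 1,K\oplus 1)$, where $\pi_r:H\oplus 1\to 1$ and $\iota_r:1\to K\oplus 1$. Identity and composition are those of $\mathbf H$. The natural isomorphism $\mathbf{expand}:(H\oplus 1)\otimes(K\oplus 1)\to(H\mid K)\oplus 1$ is the canonical one: distribute into $H\otimes K$, $H\otimes 1\cong H$, $1\otimes K\cong K$, $1\otimes 1\cong 1$, then reassociate for $\oplus$. **Colours and objects.** Colours are generated by $A,B::=\mathbf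 0\mid\mathbf 1\mid(A\oplus B)\mid(A\otimes B)$. Objects of the PROP are finite lists $A_1\parallel\dots\parallel A_n$ of colours; $\parallel$ is strictly associative, with the empty list $\varnothing$ as strict unit. $\approx$ is the smallest equivalence relation on colours that is a congruence for $\oplus$ and $\otimes$ and contains $A\oplus\mathbf 0\approx A\approx\mathbf 0\oplus A$, $A\otimes\mathbf 1\approx A\approx\mathbf 1\otimes A$, $(A\oplus B)\oplus C\approx A\oplus(B\oplus C)$, $(A\otimes B)\otimes C\approx A\otimes(B\otimes C)$. **Diagrams.** $\mathbf{FTP}^R$ (functional diagrams) is the coloured PROP (strict symmetric monoidal category) freely generated, for all colours $A,B$, by: Tensor $A\parallel B\to A\otimes B$, Plus $A\parallel B\to A\oplus B$, Contraction $A\parallel A\to A$, Null $\varnothing\to A$, the reversed (mirrored) version of each of these, Adapter $A\to A'$ whenever $A\approx A'$, and Scalar $[s]_A:A\to A$ for $s\in R$. Identities and swaps are part of the PROP structure. $\mathbf{TP}^R$ is the coloured PROP freely generated by the same generators together with the Unit $\varnothing\to\mathbf 1$ and the mirrored Unit $\mathbf 1\to\varnothing$. **Semantics of functional diagrams in $\mathbf H$.** On colours, $[\![A]\!]$ is the object of $\mathbf H$ defined recursively by: $[\![\mathbf 0]\!]=0$, $[\![\mathbf 1]\!]=1$, $[\![A\oplus B]\!]=[\![A]\!]\oplus[\![B]\!]$, $[\![A\otimes B]\!]=[\![A]\!]\otimes[\![B]\!]$. On objects: $[\![\varnothing]\!]=0$, a list consisting of a single colour $A$ is interpreted as the object $[\![A]\!]$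 of $\mathbf H$ assigned to the colour $A$ by this recursion on colours, and $[\![\mathcal X\parallel B]\!]=[\![\mathcal X]\!]\mid[\![B]\!]$. On generators: - identity $\mapsto\mathrm{id}$; swap $\mapsto\sigma^|$; $[s]_A\mapsto s\cdot\mathrm{id}$; - Plus $\mapsto\pi_r:[\![A]\!]\mid[\![B]\!]\to[\![A]\!]\oplus[\![B]\!]$, mirrored Plus $\mapsto\iota_r$; - Tensor $\mapsto\pi_\ell:[\![A]\!]\mid[\![B]\!]\to[\![A]\!]\otimes[\![B]\!]$, mirrored Tensor $\mapsto\iota_\ell$; - Contraction $\mapsto\nabla\circ\pi_r$, mirrored Contraction $\mapsto\iota_r\circ\Delta$; - Null and mirrored Null $\mapsto\mathbf{zero}$; - Adapter $A\to A'$ $\mapsto$ the canonical isomorphism $[\![A]\!]\to[\![A']\!]$ built from associators and unitors of $\otimes$ and $\oplus$ and their inverses (it is unique). Composition: $[\![e\circ d]\!]=[\![e]\!]\circ[\![d]\!]$ and $[\![d\parallel e]\!]=m^|\circ([\![d]\!]\mid[\![e]\!])\circ m^|$. **Semantics of full diagrams in $\mathbf H^{\oplus 1}$.** $[\![d]\!]^{\oplus 1}=[\![d]\!]\oplus\mathrm{id}_1$ for $d$ in $\mathbf{FTP}^R$. The Unit is sent to $\Delta\circ m^\oplus:0\oplus 1\to 1\to 1\oplus 1$, and the mirrored Unit to $m^\oplus\circ\nabla:1\oplus 1\to 1\to 0\oplus 1$. Composition: $[\![e\circ d]\!]^{\oplus 1}=[\![e]\!]^{\oplus 1}\circ[\![d]\!]^{\oplus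 1}$ and $[\![d\parallel e]\!]^{\oplus 1}=(m^|\oplus\mathrm{id}_1)\circ\mathbf{expand}\circ([\![d]\!]^{\oplus 1}\otimes[\![e]\!]^{\oplus 1})\circ\mathbf{expand}^{-1}\circ(m^|\oplus\mathrm{id}_1)$. *)

theory Defs
  imports Main
begin

section \<open>Semiadditive categories with a distributive symmetric monoidal structure\<close>

text \<open>
  The elements of \<open>'o\<close> are the objects and the elements of \<open>'m\<close> are the arrows; \<open>Dom\<close> and \<open>Cod\<close>
  are total functions.  \<open>g \<cdot> f\<close> (\<open>g\<close> after \<open>f\<close>) is only meaningful when \<open>Cod f = Dom g\<close>.  Everything about \<open>\<oplus>\<close> on arrows is derived from the universal
  properties of the biproduct, so that only objects, injections and projections are data.
\<close>

record ('o, 'm) tp_cat =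
  Dom :: "'m \<Rightarrow> 'o"
  Cod :: "'m \<Rightarrow> 'o"
  Id :: "'o \<Rightarrow> 'm"
  Comp :: "'m \<Rightarrow> 'm \<Rightarrow> 'm"  (infixr \<open>\<cdot>\<index>\<close> 55)
  Zero :: "'o"
  PlusO :: "'o \<Rightarrow> 'o \<Rightarrow> 'o"  (infixr \<open>\<oplus>\<^sub>o\<index>\<close> 65)
  InL :: "'o \<Rightarrow> 'o \<Rightarrow> 'm"
  InR :: "'o \<Rightarrow> 'o \<Rightarrow> 'm"
  PrL :: "'o \<Rightarrow> 'o \<Rightarrow> 'm"
  PrR :: "'o \<Rightarrow> 'o \<Rightarrow> 'm"
  One :: "'o"
  TensO :: "'o \<Rightarrow> 'o \<Rightarrow> 'o"  (infixr \<open>\<otimes>\<^sub>o\<index>\<close> 70)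
  Tens :: "'m \<Rightarrow> 'm \<Rightarrow> 'm"  (infixr \<open>\<otimes>\<index>\<close> 70)
  Assoc :: "'o \<Rightarrow> 'o \<Rightarrow> 'o \<Rightarrow> 'm"
  LUnit :: "'o \<Rightarrow> 'm"
  RUnit :: "'o \<Rightarrow> 'm"
  Sym :: "'o \<Rightarrow> 'o \<Rightarrow> 'm"

context
  fixes H :: "('o, 'm) tp_cat" (structure)
begin

definition hom :: "'o \<Rightarrow> 'o \<Rightarrow> 'm set" where
  "hom A B = {f. Dom H f = A \<and> Cod H f = B}"

definition inverse_arrows :: "'m \<Rightarrow> 'm \<Rightarrow> bool" where
  "inverse_arrows f g \<longleftrightarrow> Dom H g = Cod H f \<and> Cod H g = Dom H f
     \<and> g \<cdot> f = Id H (Dom H f) \<and> f \<cdot> g = Id H (Cod H f)"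

definition is_iso :: "'m \<Rightarrow> bool" where
  "is_iso f \<longleftrightarrow> (\<exists>g. inverse_arrows f g)"

definition inv_arr :: "'m \<Rightarrow> 'm" where
  "inv_arr f = (THE g. inverse_arrows f g)"

definition to_zero :: "'o \<Rightarrow> 'm" where
  "to_zero A = (THE f. f \<in> hom A (Zero H))"

definition from_zero :: "'o \<Rightarrow> 'm" where
  "from_zero A = (THE f. f \<in> hom (Zero H) A)"

definition zero_arr :: "'o \<Rightarrow> 'o \<Rightarrow> 'm" where
  "zero_arr A B = from_zero B \<cdot> to_zero A"

definition pair :: "'m \<Rightarrow> 'm \<Rightarrow> 'm" where
  "pair f g = (THE h. h \<in> hom (Dom H f) (Cod H f \<oplus>\<^sub>o Cod H g)
     \<and> PrL H (Cod H f) (Cod H g) \<cdot> h = f \<and> PrR H (Cod H f) (Cod H g) \<cdot> h = g)"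

definition copair :: "'m \<Rightarrow> 'm \<Rightarrow> 'm" where
  "copair f g = (THE h. h \<in> hom (Dom H f \<oplus>\<^sub>o Dom H g) (Cod H f)
     \<and> h \<cdot> InL H (Dom H f) (Dom H g) = f \<and> h \<cdot> InR H (Dom H f) (Dom H g) = g)"

end

definition plus_arr :: "('o, 'm) tp_cat \<Rightarrow> 'm \<Rightarrow> 'm \<Rightarrow> 'm"  (infixr \<open>\<oplus>\<index>\<close> 65) where
  "f \<oplus>\<^bsub>H\<^esub> g = pair H (f \<cdot>\<^bsub>H\<^esub> PrL H (Dom H f) (Dom H g)) (g \<cdot>\<^bsub>H\<^esub> PrR H (Dom H f) (Dom H g))"

definition diag :: "('o, 'm) tp_cat \<Rightarrow> 'o \<Rightarrow> 'm" where
  "diag H A = pair H (Id H A) (Id H A)"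

definition codiag :: "('o, 'm) tp_cat \<Rightarrow> 'o \<Rightarrow> 'm" where
  "codiag H A = copair H (Id H A) (Id H A)"

definition add_arr :: "('o, 'm) tp_cat \<Rightarrow> 'm \<Rightarrow> 'm \<Rightarrow> 'm"  (infixl \<open>\<^bold>+\<index>\<close> 60) where
  "f \<^bold>+\<^bsub>H\<^esub> g = codiag H (Cod H f) \<cdot>\<^bsub>H\<^esub> (f \<oplus>\<^bsub>H\<^esub> g) \<cdot>\<^bsub>H\<^esub> diag H (Dom H f)"

context
  fixes H :: "('o, 'm) tp_cat" (structure)
begin

subsection \<open>Structural isomorphisms of \<open>\<oplus>\<close>\<close>

definition assoc_plus :: "'o \<Rightarrow> 'o \<Rightarrow> 'o \<Rightarrow> 'm" where
  "assoc_plus A B C =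
     pair H (PrL H A B \<cdot> PrL H (A \<oplus>\<^sub>o B) C)
          (pair H (PrR H A B \<cdot> PrL H (A \<oplus>\<^sub>o B) C) (PrR H (A \<oplus>\<^sub>o B) C))"

definition lunit_plus :: "'o \<Rightarrow> 'm" where
  "lunit_plus A = PrR H (Zero H) A"

definition runit_plus :: "'o \<Rightarrow> 'm" where
  "runit_plus A = PrL H A (Zero H)"

definition sym_plus :: "'o \<Rightarrow> 'o \<Rightarrow> 'm" where
  "sym_plus A B = pair H (PrR H A B) (PrL H A B)"

subsection \<open>Canonical distributivity maps\<close>

definition distl :: "'o \<Rightarrow> 'o \<Rightarrow> 'o \<Rightarrow> 'm" where
  "distl A B C = pair H (Id H A \<otimes> PrL H B C) (Id H A \<otimes> PrR H B C)"

definition distr :: "'o \<Rightarrow> 'o \<Rightarrow> 'o \<Rightarrow> 'm" where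
  "distr A B C = pair H (PrL H A B \<otimes> Id H C) (PrR H A B \<otimes> Id H C)"

end

locale semiadditive_category =
  fixes H :: "('o, 'm) tp_cat" (structure)
  assumes Dom_Id [simp]: "Dom H (Id H A) = A"
    and Cod_Id [simp]: "Cod H (Id H A) = A"
    and Dom_Comp [simp]: "Cod H f = Dom H g \<Longrightarrow> Dom H (g \<cdot> f) = Dom H f"
    and Cod_Comp [simp]: "Cod H f = Dom H g \<Longrightarrow> Cod H (g \<cdot> f) = Cod H g"
    and Comp_Id_right: "f \<cdot> Id H (Dom H f) = f"
    and Comp_Id_left: "Id H (Cod H f) \<cdot> f = f"
    and Comp_assoc: "\<lbrakk>Cod H f = Dom H g; Cod H g = Dom H h\<rbrakk> \<Longrightarrow> (h \<cdot> g) \<cdot> f = h \<cdot> g \<cdot> f"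
    and terminal: "\<exists>!f. f \<in> hom H A (Zero H)"
    and initial: "\<exists>!f. f \<in> hom H (Zero H) A"
    and InL_in_hom: "InL H A B \<in> hom H A (A \<oplus>\<^sub>o B)"
    and InR_in_hom: "InR H A B \<in> hom H B (A \<oplus>\<^sub>o B)"
    and PrL_in_hom: "PrL H A B \<in> hom H (A \<oplus>\<^sub>o B) A"
    and PrR_in_hom: "PrR H A B \<in> hom H (A \<oplus>\<^sub>o B) B"
    and product: "\<lbrakk>f \<in> hom H C A; g \<in> hom H C B\<rbrakk> \<Longrightarrow>
          \<exists>!h. h \<in> hom H C (A \<oplus>\<^sub>o B) \<and> PrL H A B \<cdot> h = f \<and> PrR H A B \<cdot> h = g"
    and coproduct: "\<lbrakk>f \<in> hom H A C; g \<in> hom H B C\<rbrakk> \<Longrightarrow>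
          \<exists>!h. h \<in> hom H (A \<oplus>\<^sub>o B) C \<and> h \<cdot> InL H A B = f \<and> h \<cdot> InR H A B = g"
    and PrL_InL: "PrL H A B \<cdot> InL H A B = Id H A"
    and PrR_InR: "PrR H A B \<cdot> InR H A B = Id H B"
    and PrR_InL: "PrR H A B \<cdot> InL H A B = zero_arr H A B"
    and PrL_InR: "PrL H A B \<cdot> InR H A B = zero_arr H B A"

locale distributive_category = semiadditive_category H
  for H :: "('o, 'm) tp_cat" (structure) +
  assumes Dom_Tens [simp]: "Dom H (f \<otimes> g) = Dom H f \<otimes>\<^sub>o Dom H g"
    and Cod_Tens [simp]: "Cod H (f \<otimes> g) = Cod H f \<otimes>\<^sub>o Cod H g"
    and Tens_Id: "Id H A \<otimes> Id H B = Id H (A \<otimes>\<^sub>o B)"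
    and Tens_Comp: "\<lbrakk>Cod H f = Dom H g; Cod H f' = Dom H g'\<rbrakk> \<Longrightarrow>
          (g \<cdot> f) \<otimes> (g' \<cdot> f') = (g \<otimes> g') \<cdot> (f \<otimes> f')"
    and Assoc_in_hom: "Assoc H A B C \<in> hom H ((A \<otimes>\<^sub>o B) \<otimes>\<^sub>o C) (A \<otimes>\<^sub>o (B \<otimes>\<^sub>o C))"
    and LUnit_in_hom: "LUnit H A \<in> hom H (One H \<otimes>\<^sub>o A) A"
    and RUnit_in_hom: "RUnit H A \<in> hom H (A \<otimes>\<^sub>o One H) A"
    and Sym_in_hom: "Sym H A B \<in> hom H (A \<otimes>\<^sub>o B) (B \<otimes>\<^sub>o A)"
    and Assoc_iso: "is_iso H (Assoc H A B C)"
    and LUnit_iso: "is_iso H (LUnit H A)"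
    and RUnit_iso: "is_iso H (RUnit H A)"
    and Assoc_natural: "Assoc H (Cod H f) (Cod H g) (Cod H h) \<cdot> ((f \<otimes> g) \<otimes> h)
          = (f \<otimes> (g \<otimes> h)) \<cdot> Assoc H (Dom H f) (Dom H g) (Dom H h)"
    and LUnit_natural: "LUnit H (Cod H f) \<cdot> (Id H (One H) \<otimes> f) = f \<cdot> LUnit H (Dom H f)"
    and RUnit_natural: "RUnit H (Cod H f) \<cdot> (f \<otimes> Id H (One H)) = f \<cdot> RUnit H (Dom H f)"
    and Sym_natural: "Sym H (Cod H f) (Cod H g) \<cdot> (f \<otimes> g) = (g \<otimes> f) \<cdot> Sym H (Dom H f) (Dom H g)"
    and pentagon: "(Id H A \<otimes> Assoc H B C D) \<cdot> Assoc H A (B \<otimes>\<^sub>o C) D \<cdot> (Assoc H A B C \<otimes> Id H D)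
          = Assoc H A B (C \<otimes>\<^sub>o D) \<cdot> Assoc H (A \<otimes>\<^sub>o B) C D"
    and triangle: "(Id H A \<otimes> LUnit H B) \<cdot> Assoc H A (One H) B = RUnit H A \<otimes> Id H B"
    and hexagon: "Assoc H B C A \<cdot> Sym H A (B \<otimes>\<^sub>o C) \<cdot> Assoc H A B C
          = (Id H B \<otimes> Sym H A C) \<cdot> Assoc H B A C \<cdot> (Sym H A B \<otimes> Id H C)"
    and Sym_Sym: "Sym H B A \<cdot> Sym H A B = Id H (A \<otimes>\<^sub>o B)"
    and distl_iso: "is_iso H (distl H A B C)"
    and annihilate_iso: "is_iso H (to_zero H (A \<otimes>\<^sub>o Zero H))"

text \<open>
  \<open>scal\<close> is an isomorphism from the commutative semiring \<open>'r\<close> onto the endomorphisms of the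
  tensor unit.  The sort of \<open>'r\<close> avoids \<open>comm_semiring_1\<close>, which would exclude the semiring with
  \<open>0 = 1\<close>.
\<close>

locale tp_model = distributive_category H
  for H :: "('o, 'm) tp_cat" (structure)
    and scal :: "'r::{comm_semiring_0, comm_monoid_mult} \<Rightarrow> 'm" +
  assumes scal_bij: "bij_betw scal UNIV (hom H (One H) (One H))"
    and scal_zero: "scal 0 = zero_arr H (One H) (One H)"
    and scal_one: "scal 1 = Id H (One H)"
    and scal_add: "scal (r + s) = scal r \<^bold>+ scal s"
    and scal_mult: "scal (r * s) = scal r \<cdot> scal s"

definition smult :: "('o, 'm) tp_cat \<Rightarrow> ('r \<Rightarrow> 'm) \<Rightarrow> 'r \<Rightarrow> 'm \<Rightarrow> 'm" where
  "smult H scal s f =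
     LUnit H (Cod H f) \<cdot>\<^bsub>H\<^esub> (scal s \<otimes>\<^bsub>H\<^esub> f) \<cdot>\<^bsub>H\<^esub> inv_arr H (LUnit H (Dom H f))"

section \<open>The product \<open>H | K\<close>\<close>

definition BarO :: "('o, 'm) tp_cat \<Rightarrow> 'o \<Rightarrow> 'o \<Rightarrow> 'o"  (infixr \<open>\<star>\<^sub>o\<index>\<close> 68) where
  "A \<star>\<^sub>o\<^bsub>H\<^esub> B = (A \<otimes>\<^sub>o\<^bsub>H\<^esub> B) \<oplus>\<^sub>o\<^bsub>H\<^esub> (A \<oplus>\<^sub>o\<^bsub>H\<^esub> B)"

definition Bar :: "('o, 'm) tp_cat \<Rightarrow> 'm \<Rightarrow> 'm \<Rightarrow> 'm"  (infixr \<open>\<star>\<index>\<close> 68) where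
  "f \<star>\<^bsub>H\<^esub> g = (f \<otimes>\<^bsub>H\<^esub> g) \<oplus>\<^bsub>H\<^esub> (f \<oplus>\<^bsub>H\<^esub> g)"

context
  fixes H :: "('o, 'm) tp_cat" (structure)
begin

definition lunit_bar :: "'o \<Rightarrow> 'm" where
  "lunit_bar A = PrR H (Zero H) A \<cdot> PrR H (Zero H \<otimes>\<^sub>o A) (Zero H \<oplus>\<^sub>o A)"

definition runit_bar :: "'o \<Rightarrow> 'm" where
  "runit_bar A = PrL H A (Zero H) \<cdot> PrR H (A \<otimes>\<^sub>o Zero H) (A \<oplus>\<^sub>o Zero H)"

definition sym_bar :: "'o \<Rightarrow> 'o \<Rightarrow> 'm" where
  "sym_bar A B = Sym H A B \<oplus> sym_plus H A B"

text \<open>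
  The associator of \<open>|\<close> matches the summands of two sevenfold expansions.  With \<open>AB\<close> for the tensor product of
  \<open>A\<close> and \<open>B\<close> etc., the target of \<open>expand3l A B C\<close> is
  \<open>((AB)C \<oplus> (AC \<oplus> BC)) \<oplus> ((AB \<oplus> (A \<oplus> B)) \<oplus> C)\<close>
  and the target of \<open>expand3r A B C\<close> is
  \<open>(A(BC) \<oplus> (AB \<oplus> AC)) \<oplus> (A \<oplus> (BC \<oplus> (B \<oplus> C)))\<close>.
\<close>

definition expand3l :: "'o \<Rightarrow> 'o \<Rightarrow> 'o \<Rightarrow> 'm" where
  "expand3l A B C =
     ((Id H ((A \<otimes>\<^sub>o B) \<otimes>\<^sub>o C) \<oplus> distr H A B C) \<cdot> distr H (A \<otimes>\<^sub>o B) (A \<oplus>\<^sub>o B) C)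
       \<oplus> Id H ((A \<star>\<^sub>o B) \<oplus>\<^sub>o C)"

definition expand3r :: "'o \<Rightarrow> 'o \<Rightarrow> 'o \<Rightarrow> 'm" where
  "expand3r A B C =
     ((Id H (A \<otimes>\<^sub>o (B \<otimes>\<^sub>o C)) \<oplus> distl H A B C) \<cdot> distl H A (B \<otimes>\<^sub>o C) (B \<oplus>\<^sub>o C))
       \<oplus> Id H (A \<oplus>\<^sub>o (B \<star>\<^sub>o C))"

definition match3 :: "'o \<Rightarrow> 'o \<Rightarrow> 'o \<Rightarrow> 'm" where
  "match3 A B C =
    (let
       ABC = (A \<otimes>\<^sub>o B) \<otimes>\<^sub>o C; AC = A \<otimes>\<^sub>o C; BC = B \<otimes>\<^sub>o C; AB = A \<otimes>\<^sub>o B;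
       t = PrL H (ABC \<oplus>\<^sub>o (AC \<oplus>\<^sub>o BC)) ((AB \<oplus>\<^sub>o (A \<oplus>\<^sub>o B)) \<oplus>\<^sub>o C);
       u = PrR H (ABC \<oplus>\<^sub>o (AC \<oplus>\<^sub>o BC)) ((AB \<oplus>\<^sub>o (A \<oplus>\<^sub>o B)) \<oplus>\<^sub>o C);
       pABC = PrL H ABC (AC \<oplus>\<^sub>o BC) \<cdot> t;
       pAC = PrL H AC BC \<cdot> PrR H ABC (AC \<oplus>\<^sub>o BC) \<cdot> t;
       pBC = PrR H AC BC \<cdot> PrR H ABC (AC \<oplus>\<^sub>o BC) \<cdot> t;
       v = PrL H (AB \<oplus>\<^sub>o (A \<oplus>\<^sub>o B)) C \<cdot> u;
       pAB = PrL H AB (A \<oplus>\<^sub>o B) \<cdot> v;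
       pA = PrL H A B \<cdot> PrR H AB (A \<oplus>\<^sub>o B) \<cdot> v;
       pB = PrR H A B \<cdot> PrR H AB (A \<oplus>\<^sub>o B) \<cdot> v;
       pC = PrR H (AB \<oplus>\<^sub>o (A \<oplus>\<^sub>o B)) C \<cdot> u
     in pair H (pair H (Assoc H A B C \<cdot> pABC) (pair H pAB pAC))
               (pair H pA (pair H pBC (pair H pB pC))))"

definition assoc_bar :: "'o \<Rightarrow> 'o \<Rightarrow> 'o \<Rightarrow> 'm" where
  "assoc_bar A B C = inv_arr H (expand3r A B C) \<cdot> match3 A B C \<cdot> expand3l A B C"

section \<open>The category with an adjoined unit\<close>

definition Plus1O :: "'o \<Rightarrow> 'o" where
  "Plus1O A = A \<oplus>\<^sub>o One H"

definition Plus1 :: "'m \<Rightarrow> 'm" where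
  "Plus1 f = f \<oplus> Id H (One H)"

definition hom1 :: "'o \<Rightarrow> 'o \<Rightarrow> 'm set" where
  "hom1 A B = {g \<^bold>+ (InR H B (One H) \<cdot> PrR H A (One H)) | g. g \<in> hom H (Plus1O A) (Plus1O B)}"

text \<open>
  \<open>(A \<oplus> 1)(B \<oplus> 1)\<close>, \<open>A(B \<oplus> 1) \<oplus> 1(B \<oplus> 1)\<close>, \<open>(AB \<oplus> A1) \<oplus> (1B \<oplus> 11)\<close>, \<open>(AB \<oplus> A) \<oplus> (B \<oplus> 1)\<close>,
  \<open>((AB \<oplus> A) \<oplus> B) \<oplus> 1\<close>, \<open>(AB \<oplus> (A \<oplus> B)) \<oplus> 1\<close>
\<close>

definition expand :: "'o \<Rightarrow> 'o \<Rightarrow> 'm" where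
  "expand A B =
     (assoc_plus H (A \<otimes>\<^sub>o B) A B \<oplus> Id H (One H))
     \<cdot> inv_arr H (assoc_plus H ((A \<otimes>\<^sub>o B) \<oplus>\<^sub>o A) B (One H))
     \<cdot> ((Id H (A \<otimes>\<^sub>o B) \<oplus> RUnit H A) \<oplus> (LUnit H B \<oplus> LUnit H (One H)))
     \<cdot> (distl H A B (One H) \<oplus> distl H (One H) B (One H))
     \<cdot> distr H A (One H) (B \<oplus>\<^sub>o One H)"

end

section \<open>Colours and diagrams\<close>

datatype colour = C0 | C1 | CPlus colour colour | CTens colour colour

inductive ceq :: "colour \<Rightarrow> colour \<Rightarrow> bool"  (infix \<open>\<approx>\<close> 50) where
  ceq_refl: "A \<approx> A"
| ceq_sym: "A \<approx> B \<Longrightarrow> B \<approx> A"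
| ceq_trans: "A \<approx> B \<Longrightarrow> B \<approx> C \<Longrightarrow> A \<approx> C"
| ceq_plus: "A \<approx> A' \<Longrightarrow> B \<approx> B' \<Longrightarrow> CPlus A B \<approx> CPlus A' B'"
| ceq_tens: "A \<approx> A' \<Longrightarrow> B \<approx> B' \<Longrightarrow> CTens A B \<approx> CTens A' B'"
| ceq_plus_right: "CPlus A C0 \<approx> A"
| ceq_plus_left: "CPlus C0 A \<approx> A"
| ceq_tens_right: "CTens A C1 \<approx> A"
| ceq_tens_left: "CTens C1 A \<approx> A"
| ceq_plus_assoc: "CPlus (CPlus A B) C \<approx> CPlus A (CPlus B C)"
| ceq_tens_assoc: "CTens (CTens A B) C \<approx> CTens A (CTens B C)"

text \<open>A prime marks the mirrored version of a generator.\<close>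

datatype 'r fgen =
    Tensor colour colour | Tensor' colour colour
  | Plus colour colour | Plus' colour colour
  | Contraction colour | Contraction' colour
  | Null colour | Null' colour
  | Adapter colour colour
  | Scalar 'r colour

datatype 'r gen = Fun "'r fgen" | Unit | Unit'

fun fgen_dom :: "'r fgen \<Rightarrow> colour list" where
  "fgen_dom (Tensor A B) = [A, B]"
| "fgen_dom (Tensor' A B) = [CTens A B]"
| "fgen_dom (Plus A B) = [A, B]"
| "fgen_dom (Plus' A B) = [CPlus A B]"
| "fgen_dom (Contraction A) = [A, A]"
| "fgen_dom (Contraction' A) = [A]"
| "fgen_dom (Null A) = []"
| "fgen_dom (Null' A) = [A]"
| "fgen_dom (Adapter A B) = [A]"
| "fgen_dom (Scalar s A) = [A]"

fun fgen_cod :: "'r fgen \<Rightarrow> colour list" where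
  "fgen_cod (Tensor A B) = [CTens A B]"
| "fgen_cod (Tensor' A B) = [A, B]"
| "fgen_cod (Plus A B) = [CPlus A B]"
| "fgen_cod (Plus' A B) = [A, B]"
| "fgen_cod (Contraction A) = [A]"
| "fgen_cod (Contraction' A) = [A, A]"
| "fgen_cod (Null A) = [A]"
| "fgen_cod (Null' A) = []"
| "fgen_cod (Adapter A B) = [B]"
| "fgen_cod (Scalar s A) = [A]"

fun fgen_ok :: "'r fgen \<Rightarrow> bool" where
  "fgen_ok (Adapter A B) \<longleftrightarrow> A \<approx> B"
| "fgen_ok _ \<longleftrightarrow> True"

fun gen_dom :: "'r gen \<Rightarrow> colour list" where
  "gen_dom (Fun g) = fgen_dom g"
| "gen_dom Unit = []"
| "gen_dom Unit' = [C1]"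

fun gen_cod :: "'r gen \<Rightarrow> colour list" where
  "gen_cod (Fun g) = fgen_cod g"
| "gen_cod Unit = [C1]"
| "gen_cod Unit' = []"

fun gen_ok :: "'r gen \<Rightarrow> bool" where
  "gen_ok (Fun g) \<longleftrightarrow> fgen_ok g"
| "gen_ok _ \<longleftrightarrow> True"

subsection \<open>Free coloured PROPs\<close>

text \<open>
  The free coloured PROP over a signature (\<open>D\<close>, \<open>C\<close>: source and target of a generator, \<open>ok\<close>: the
  admissible generators) is the set of well-formed terms modulo the equations of a strict symmetric
  monoidal category.  \<open>TSeq e d\<close> is \<open>e\<close> after \<open>d\<close>.
\<close>

datatype 'g pterm =
    TGen 'g
  | TId "colour list"
  | TSwap "colour list" "colour list"
  | TSeq "'g pterm" "'g pterm"
  | TPar "'g pterm" "'g pterm"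

context
  fixes D C :: "'g \<Rightarrow> colour list" and ok :: "'g \<Rightarrow> bool"
begin

primrec tdom :: "'g pterm \<Rightarrow> colour list" where
  "tdom (TGen g) = D g"
| "tdom (TId X) = X"
| "tdom (TSwap X Y) = X @ Y"
| "tdom (TSeq e d) = tdom d"
| "tdom (TPar d e) = tdom d @ tdom e"

primrec tcod :: "'g pterm \<Rightarrow> colour list" where
  "tcod (TGen g) = C g"
| "tcod (TId X) = X"
| "tcod (TSwap X Y) = Y @ X"
| "tcod (TSeq e d) = tcod e"
| "tcod (TPar d e) = tcod d @ tcod e"

primrec twf :: "'g pterm \<Rightarrow> bool" where
  "twf (TGen g) \<longleftrightarrow> ok g"
| "twf (TId X) \<longleftrightarrow> True"
| "twf (TSwap X Y) \<longleftrightarrow> True"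
| "twf (TSeq e d) \<longleftrightarrow> twf d \<and> twf e \<and> tcod d = tdom e"
| "twf (TPar d e) \<longleftrightarrow> twf d \<and> twf e"

definition terms :: "colour list \<Rightarrow> colour list \<Rightarrow> 'g pterm set" where
  "terms X Y = {d. twf d \<and> tdom d = X \<and> tcod d = Y}"

inductive peq :: "'g pterm \<Rightarrow> 'g pterm \<Rightarrow> bool" where
  peq_refl: "twf d \<Longrightarrow> peq d d"
| peq_sym: "peq d e \<Longrightarrow> peq e d"
| peq_trans: "peq d e \<Longrightarrow> peq e k \<Longrightarrow> peq d k"
| peq_seq: "peq d d' \<Longrightarrow> peq e e' \<Longrightarrow> tcod d = tdom e \<Longrightarrow> peq (TSeq e d) (TSeq e' d')"
| peq_par: "peq d d' \<Longrightarrow> peq e e' \<Longrightarrow> peq (TPar d e) (TPar d' e')"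
| peq_seq_assoc: "twf (TSeq k (TSeq e d)) \<Longrightarrow> peq (TSeq k (TSeq e d)) (TSeq (TSeq k e) d)"
| peq_id_right: "twf d \<Longrightarrow> peq (TSeq d (TId (tdom d))) d"
| peq_id_left: "twf d \<Longrightarrow> peq (TSeq (TId (tcod d)) d) d"
| peq_par_assoc: "twf (TPar (TPar d e) k) \<Longrightarrow> peq (TPar (TPar d e) k) (TPar d (TPar e k))"
| peq_par_right: "twf d \<Longrightarrow> peq (TPar d (TId [])) d"
| peq_par_left: "twf d \<Longrightarrow> peq (TPar (TId []) d) d"
| peq_par_id: "peq (TPar (TId X) (TId Y)) (TId (X @ Y))"
| peq_interchange: "twf (TSeq e d) \<Longrightarrow> twf (TSeq e' d') \<Longrightarrow>
    peq (TPar (TSeq e d) (TSeq e' d')) (TSeq (TPar e e') (TPar d d'))"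
| peq_swap_natural: "twf d \<Longrightarrow> twf e \<Longrightarrow>
    peq (TSeq (TSwap (tcod d) (tcod e)) (TPar d e)) (TSeq (TPar e d) (TSwap (tdom d) (tdom e)))"
| peq_swap_swap: "peq (TSeq (TSwap Y X) (TSwap X Y)) (TId (X @ Y))"
| peq_swap_append: "peq (TSwap X (Y @ Z))
    (TSeq (TPar (TId Y) (TSwap X Z)) (TPar (TSwap X Y) (TId Z)))"

definition prop_hom :: "colour list \<Rightarrow> colour list \<Rightarrow> 'g pterm set set" where
  "prop_hom X Y = terms X Y // {(d, e). peq d e}"

end

definition FTP :: "colour list \<Rightarrow> colour list \<Rightarrow> 'r fgen pterm set set" where
  "FTP = prop_hom fgen_dom fgen_cod fgen_ok"

definition TP :: "colour list \<Rightarrow> colour list \<Rightarrow> 'r gen pterm set set" where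
  "TP = prop_hom gen_dom gen_cod gen_ok"

section \<open>Semantics\<close>

context
  fixes H :: "('o, 'm) tp_cat" (structure)
begin

primrec csem :: "colour \<Rightarrow> 'o" where
  "csem C0 = Zero H"
| "csem C1 = One H"
| "csem (CPlus A B) = csem A \<oplus>\<^sub>o csem B"
| "csem (CTens A B) = csem A \<otimes>\<^sub>o csem B"

text \<open>
  Nonempty lists are bracketed to the left, starting from the first colour itself, so that a one
  element list denotes the object of its colour (and not \<open>0 | A\<close>).
\<close>

fun osem :: "colour list \<Rightarrow> 'o" where
  "osem [] = Zero H"
| "osem (A # X) = foldl (\<lambda>K B. K \<star>\<^sub>o csem B) (csem A) X"

inductive canonical :: "colour \<Rightarrow> colour \<Rightarrow> 'm \<Rightarrow> bool" where
  "canonical A A (Id H (csem A))"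
| "canonical A B f \<Longrightarrow> canonical B A (inv_arr H f)"
| "canonical A B f \<Longrightarrow> canonical B C g \<Longrightarrow> canonical A C (g \<cdot> f)"
| "canonical A A' f \<Longrightarrow> canonical B B' g \<Longrightarrow> canonical (CPlus A B) (CPlus A' B') (f \<oplus> g)"
| "canonical A A' f \<Longrightarrow> canonical B B' g \<Longrightarrow> canonical (CTens A B) (CTens A' B') (f \<otimes> g)"
| "canonical (CPlus A C0) A (runit_plus H (csem A))"
| "canonical (CPlus C0 A) A (lunit_plus H (csem A))"
| "canonical (CTens A C1) A (RUnit H (csem A))"
| "canonical (CTens C1 A) A (LUnit H (csem A))"
| "canonical (CPlus (CPlus A B) C) (CPlus A (CPlus B C)) (assoc_plus H (csem A) (csem B) (csem C))"
| "canonical (CTens (CTens A B) C) (CTens A (CTens B C)) (Assoc H (csem A) (csem B) (csem C))"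

text \<open>
  Such an arrow exists whenever \<open>A \<approx> B\<close>, and it is unique by coherence for the two (unrelated)
  monoidal structures; \<open>SOME\<close> picks it without appealing to coherence.
\<close>

definition adapter :: "colour \<Rightarrow> colour \<Rightarrow> 'm" where
  "adapter A B = (SOME f. canonical A B f)"

text \<open>
  The canonical rebracketing \<open>[[X]] | [[Y]] \<rightarrow> [[X @ Y]]\<close>.  The second list is traversed from its last
  colour, hence is passed in reverse to \<open>merge_rev\<close>.
\<close>

fun merge_rev :: "colour list \<Rightarrow> colour list \<Rightarrow> 'm" where
  "merge_rev X [] = runit_bar H (osem X)"
| "merge_rev X [B] = (if X = [] then lunit_bar H (csem B) else Id H (osem X \<star>\<^sub>o csem B))"
| "merge_rev X (B # C # Y) =
     (merge_rev X (C # Y) \<star> Id H (csem B)) \<cdot> inv_arr H (assoc_bar H (osem X) (osem (rev (C # Y))) (csem B))"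

definition merge :: "colour list \<Rightarrow> colour list \<Rightarrow> 'm" where
  "merge X Y = merge_rev X (rev Y)"

text \<open>For single colours \<open>A\<close>, \<open>B\<close>, \<open>merge [A] [B]\<close> is an identity and the swap denotes
  \<open>sym_bar\<close> itself.\<close>

definition swap_sem :: "colour list \<Rightarrow> colour list \<Rightarrow> 'm" where
  "swap_sem X Y = merge Y X \<cdot> sym_bar H (osem X) (osem Y) \<cdot> inv_arr H (merge X Y)"

fun fgen_sem :: "('r \<Rightarrow> 'm) \<Rightarrow> 'r fgen \<Rightarrow> 'm" where
  "fgen_sem scal (Tensor A B) = PrL H (csem A \<otimes>\<^sub>o csem B) (csem A \<oplus>\<^sub>o csem B)"
| "fgen_sem scal (Tensor' A B) = InL H (csem A \<otimes>\<^sub>o csem B) (csem A \<oplus>\<^sub>o csem B)"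
| "fgen_sem scal (Plus A B) = PrR H (csem A \<otimes>\<^sub>o csem B) (csem A \<oplus>\<^sub>o csem B)"
| "fgen_sem scal (Plus' A B) = InR H (csem A \<otimes>\<^sub>o csem B) (csem A \<oplus>\<^sub>o csem B)"
| "fgen_sem scal (Contraction A) =
     codiag H (csem A) \<cdot> PrR H (csem A \<otimes>\<^sub>o csem A) (csem A \<oplus>\<^sub>o csem A)"
| "fgen_sem scal (Contraction' A) =
     InR H (csem A \<otimes>\<^sub>o csem A) (csem A \<oplus>\<^sub>o csem A) \<cdot> diag H (csem A)"
| "fgen_sem scal (Null A) = zero_arr H (Zero H) (csem A)"
| "fgen_sem scal (Null' A) = zero_arr H (csem A) (Zero H)"
| "fgen_sem scal (Adapter A B) = adapter A B"
| "fgen_sem scal (Scalar s A) = smult H scal s (Id H (csem A))"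

primrec fsem :: "('r \<Rightarrow> 'm) \<Rightarrow> 'r fgen pterm \<Rightarrow> 'm" where
  "fsem scal (TGen g) = fgen_sem scal g"
| "fsem scal (TId X) = Id H (osem X)"
| "fsem scal (TSwap X Y) = swap_sem X Y"
| "fsem scal (TSeq e d) = fsem scal e \<cdot> fsem scal d"
| "fsem scal (TPar d e) =
     merge (tcod fgen_cod d) (tcod fgen_cod e)
     \<cdot> (fsem scal d \<star> fsem scal e)
     \<cdot> inv_arr H (merge (tdom fgen_dom d) (tdom fgen_dom e))"

text \<open>
  The semantics of a functional diagram \<open>d\<close> is \<open>[[d]] \<oplus> id\<close>.  Here this is stipulated for generators,
  identities and swaps; for all functional diagrams it is \<open>sem_functional\<close> below.
\<close>

fun gen_sem :: "('r \<Rightarrow> 'm) \<Rightarrow> 'r gen \<Rightarrow> 'm" where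
  "gen_sem scal (Fun g) = Plus1 H (fgen_sem scal g)"
| "gen_sem scal Unit = diag H (One H) \<cdot> lunit_plus H (One H)"
| "gen_sem scal Unit' = inv_arr H (lunit_plus H (One H)) \<cdot> codiag H (One H)"

primrec sem :: "('r \<Rightarrow> 'm) \<Rightarrow> 'r gen pterm \<Rightarrow> 'm" where
  "sem scal (TGen g) = gen_sem scal g"
| "sem scal (TId X) = Plus1 H (Id H (osem X))"
| "sem scal (TSwap X Y) = Plus1 H (swap_sem X Y)"
| "sem scal (TSeq e d) = sem scal e \<cdot> sem scal d"
| "sem scal (TPar d e) =
     Plus1 H (merge (tcod gen_cod d) (tcod gen_cod e))
     \<cdot> expand H (osem (tcod gen_cod d)) (osem (tcod gen_cod e))
     \<cdot> (sem scal d \<otimes> sem scal e)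
     \<cdot> inv_arr H (expand H (osem (tdom gen_dom d)) (osem (tdom gen_dom e)))
     \<cdot> Plus1 H (inv_arr H (merge (tdom gen_dom d) (tdom gen_dom e)))"

text \<open>The common value of \<open>sem\<close> on the representatives of a morphism, see \<open>peq_sem\<close> and
  \<open>TP_sem_class\<close> below.\<close>

definition TP_sem :: "('r \<Rightarrow> 'm) \<Rightarrow> 'r gen pterm set \<Rightarrow> 'm" where
  "TP_sem scal K = (THE f. \<exists>d\<in>K. f = sem scal d)"

end

section \<open>Calculus of biproducts and isomorphisms\<close>

context semiadditive_category
begin

lemma Dom_InL [simp]: "Dom H (InL H A B) = A" and Cod_InL [simp]: "Cod H (InL H A B) = A \<oplus>\<^sub>o B"
  and Dom_InR [simp]: "Dom H (InR H A B) = B" and Cod_InR [simp]: "Cod H (InR H A B) = A \<oplus>\<^sub>o B"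
  and Dom_PrL [simp]: "Dom H (PrL H A B) = A \<oplus>\<^sub>o B" and Cod_PrL [simp]: "Cod H (PrL H A B) = A"
  and Dom_PrR [simp]: "Dom H (PrR H A B) = A \<oplus>\<^sub>o B" and Cod_PrR [simp]: "Cod H (PrR H A B) = B"
  using InL_in_hom InR_in_hom PrL_in_hom PrR_in_hom by (auto simp: hom_def)

lemma Id_right [simp]: "Dom H f = A \<Longrightarrow> f \<cdot> Id H A = f"
  using Comp_Id_right by blast

lemma Id_left [simp]: "Cod H f = A \<Longrightarrow> Id H A \<cdot> f = f"
  using Comp_Id_left by blast

declare Comp_assoc [simp]

lemma pair_facts:
  assumes "Dom H f = Dom H g"
  shows "pair H f g \<in> hom H (Dom H f) (Cod H f \<oplus>\<^sub>o Cod H g) \<and>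
    PrL H (Cod H f) (Cod H g) \<cdot> pair H f g = f \<and> PrR H (Cod H f) (Cod H g) \<cdot> pair H f g = g"
  unfolding pair_def
  by (rule theI', rule product) (use assms in \<open>auto simp: hom_def\<close>)

lemma Dom_pair [simp]: "Dom H f = Dom H g \<Longrightarrow> Dom H (pair H f g) = Dom H f"
  and Cod_pair [simp]: "Dom H f = Dom H g \<Longrightarrow> Cod H (pair H f g) = Cod H f \<oplus>\<^sub>o Cod H g"
  and PrL_pair [simp]: "Dom H f = Dom H g \<Longrightarrow> Cod H f = A \<Longrightarrow> Cod H g = B \<Longrightarrow> PrL H A B \<cdot> pair H f g = f"
  and PrR_pair [simp]: "Dom H f = Dom H g \<Longrightarrow> Cod H f = A \<Longrightarrow> Cod H g = B \<Longrightarrow> PrR H A B \<cdot> pair H f g = g"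
  using pair_facts[of f g] by (auto simp: hom_def)

lemma product_ext:
  assumes "Dom H h = Dom H h'" "Cod H h = A \<oplus>\<^sub>o B" "Cod H h' = A \<oplus>\<^sub>o B"
    and "PrL H A B \<cdot> h = PrL H A B \<cdot> h'" "PrR H A B \<cdot> h = PrR H A B \<cdot> h'"
  shows "h = h'"
  using product[of "PrL H A B \<cdot> h" "Dom H h" A "PrR H A B \<cdot> h" B] assms
  by (auto simp: hom_def)

lemma pair_Comp [simp]:
  "Dom H f = Dom H g \<Longrightarrow> Cod H h = Dom H g \<Longrightarrow> pair H f g \<cdot> h = pair H (f \<cdot> h) (g \<cdot> h)"
  by (rule product_ext[where A = "Cod H f" and B = "Cod H g"]) (auto simp flip: Comp_assoc)

lemma PrL_pair_Comp [simp]: "Dom H f = Dom H g \<Longrightarrow> Cod H f = A \<Longrightarrow> Cod H g = B \<Longrightarrow> Cod H h = Dom H f \<Longrightarrow> PrL H A B \<cdot> pair H f g \<cdot> h = f \<cdot> h"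
  and PrR_pair_Comp [simp]: "Dom H f = Dom H g \<Longrightarrow> Cod H f = A \<Longrightarrow> Cod H g = B \<Longrightarrow> Cod H h = Dom H f \<Longrightarrow> PrR H A B \<cdot> pair H f g \<cdot> h = g \<cdot> h"
  by (auto simp flip: Comp_assoc)

lemma pair_PrL_PrR [simp]: "pair H (PrL H A B) (PrR H A B) = Id H (A \<oplus>\<^sub>o B)"
  by (rule product_ext[where A = A and B = B]) auto

lemma pair_eta: "Cod H h = A \<oplus>\<^sub>o B \<Longrightarrow> pair H (PrL H A B \<cdot> h) (PrR H A B \<cdot> h) = h"
  by (rule product_ext[where A = A and B = B]) auto

lemma Dom_plus [simp]: "Dom H (f \<oplus> g) = Dom H f \<oplus>\<^sub>o Dom H g"
  and Cod_plus [simp]: "Cod H (f \<oplus> g) = Cod H f \<oplus>\<^sub>o Cod H g"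
  by (auto simp: plus_arr_def)

lemma PrL_plus: "Cod H f = A \<Longrightarrow> Cod H g = B \<Longrightarrow> PrL H A B \<cdot> (f \<oplus> g) = f \<cdot> PrL H (Dom H f) (Dom H g)"
  and PrR_plus: "Cod H f = A \<Longrightarrow> Cod H g = B \<Longrightarrow> PrR H A B \<cdot> (f \<oplus> g) = g \<cdot> PrR H (Dom H f) (Dom H g)"
  by (auto simp: plus_arr_def)

lemma PrL_plus_Comp: "Cod H f = A \<Longrightarrow> Cod H g = B \<Longrightarrow> Cod H h = Dom H f \<oplus>\<^sub>o Dom H g \<Longrightarrow>
    PrL H A B \<cdot> (f \<oplus> g) \<cdot> h = f \<cdot> PrL H (Dom H f) (Dom H g) \<cdot> h"
  and PrR_plus_Comp: "Cod H f = A \<Longrightarrow> Cod H g = B \<Longrightarrow> Cod H h = Dom H f \<oplus>\<^sub>o Dom H g \<Longrightarrow>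
    PrR H A B \<cdot> (f \<oplus> g) \<cdot> h = g \<cdot> PrR H (Dom H f) (Dom H g) \<cdot> h"
  by (auto simp: plus_arr_def)

lemma plus_pair [simp]:
  "Dom H h = Dom H k \<Longrightarrow> Cod H h = Dom H f \<Longrightarrow> Cod H k = Dom H g \<Longrightarrow>
   (f \<oplus> g) \<cdot> pair H h k = pair H (f \<cdot> h) (g \<cdot> k)"
  by (auto simp: plus_arr_def)

lemma plus_Id [simp]: "Id H A \<oplus> Id H B = Id H (A \<oplus>\<^sub>o B)"
  by (auto simp: plus_arr_def)

lemma plus_Comp:
  "Cod H f = Dom H f' \<Longrightarrow> Cod H g = Dom H g' \<Longrightarrow> (f' \<cdot> f) \<oplus> (g' \<cdot> g) = (f' \<oplus> g') \<cdot> (f \<oplus> g)"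
  by (auto simp: plus_arr_def)

subsection \<open>Isomorphisms\<close>

lemma inverse_arrows_unique: "inverse_arrows H f g \<Longrightarrow> inverse_arrows H f g' \<Longrightarrow> g = g'"
  unfolding inverse_arrows_def by (metis Comp_Id_left Comp_Id_right Comp_assoc)

lemma inv_arr_eqI: "inverse_arrows H f g \<Longrightarrow> inv_arr H f = g"
  unfolding inv_arr_def using inverse_arrows_unique by blast

lemma is_isoI: "Dom H g = Cod H f \<Longrightarrow> Cod H g = Dom H f \<Longrightarrow> g \<cdot> f = Id H (Dom H f) \<Longrightarrow> f \<cdot> g = Id H (Cod H f)
   \<Longrightarrow> is_iso H f"
  unfolding is_iso_def inverse_arrows_def by blast

lemma inverse_arrows_inv: "is_iso H f \<Longrightarrow> inverse_arrows H f (inv_arr H f)"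
  unfolding is_iso_def using inv_arr_eqI by blast

lemma Dom_inv [simp]: "is_iso H f \<Longrightarrow> Dom H (inv_arr H f) = Cod H f"
  and Cod_inv [simp]: "is_iso H f \<Longrightarrow> Cod H (inv_arr H f) = Dom H f"
  and inv_Comp [simp]: "is_iso H f \<Longrightarrow> inv_arr H f \<cdot> f = Id H (Dom H f)"
  and Comp_inv [simp]: "is_iso H f \<Longrightarrow> f \<cdot> inv_arr H f = Id H (Cod H f)"
  using inverse_arrows_inv[of f] by (auto simp: inverse_arrows_def)

lemma inv_Comp_Comp [simp]: "is_iso H f \<Longrightarrow> Cod H g = Dom H f \<Longrightarrow> inv_arr H f \<cdot> f \<cdot> g = g"
  and Comp_inv_Comp [simp]: "is_iso H f \<Longrightarrow> Cod H g = Cod H f \<Longrightarrow> f \<cdot> inv_arr H f \<cdot> g = g"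
  by (auto simp flip: Comp_assoc)

lemma iso_inv [simp]: "is_iso H f \<Longrightarrow> is_iso H (inv_arr H f)"
  by (rule is_isoI[of f]) auto

lemma inv_inv [simp]: "is_iso H f \<Longrightarrow> inv_arr H (inv_arr H f) = f"
  by (rule inv_arr_eqI) (auto simp: inverse_arrows_def)

lemma iso_Id [simp]: "is_iso H (Id H A)"
  by (rule is_isoI[of "Id H A"]) auto

lemma inv_Id [simp]: "inv_arr H (Id H A) = Id H A"
  by (rule inv_arr_eqI) (auto simp: inverse_arrows_def)

lemma iso_Comp [simp]: "is_iso H f \<Longrightarrow> is_iso H g \<Longrightarrow> Cod H f = Dom H g \<Longrightarrow> is_iso H (g \<cdot> f)"
  by (rule is_isoI[of "inv_arr H f \<cdot> inv_arr H g"]) auto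

lemma inv_of_Comp: "is_iso H f \<Longrightarrow> is_iso H g \<Longrightarrow> Cod H f = Dom H g \<Longrightarrow>
    inv_arr H (g \<cdot> f) = inv_arr H f \<cdot> inv_arr H g"
  by (rule inv_arr_eqI) (auto simp: inverse_arrows_def)

lemma iso_plus [simp]: "is_iso H f \<Longrightarrow> is_iso H g \<Longrightarrow> is_iso H (f \<oplus> g)"
  by (rule is_isoI[of "inv_arr H f \<oplus> inv_arr H g"]) (auto simp flip: plus_Comp)

lemma inv_plus: "is_iso H f \<Longrightarrow> is_iso H g \<Longrightarrow> inv_arr H (f \<oplus> g) = inv_arr H f \<oplus> inv_arr H g"
  by (rule inv_arr_eqI) (auto simp: inverse_arrows_def simp flip: plus_Comp)

lemma iso_cancel_right:
  assumes "is_iso H p" "Cod H p = Dom H f" "Cod H p = Dom H g" "f \<cdot> p = g \<cdot> p"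
  shows "f = g"
proof -
  have "(f \<cdot> p) \<cdot> inv_arr H p = (g \<cdot> p) \<cdot> inv_arr H p" using assms by simp
  then show ?thesis using assms(1-3) by simp
qed

lemma iso_cancel_left:
  assumes "is_iso H p" "Dom H p = Cod H f" "Dom H p = Cod H g" "p \<cdot> f = p \<cdot> g"
  shows "f = g"
proof -
  have "inv_arr H p \<cdot> (p \<cdot> f) = inv_arr H p \<cdot> (p \<cdot> g)" using assms by simp
  then show ?thesis using assms(1-3) by simp
qed

lemma Dom_assoc_plus [simp]: "Dom H (assoc_plus H A B C) = (A \<oplus>\<^sub>o B) \<oplus>\<^sub>o C"
  and Cod_assoc_plus [simp]: "Cod H (assoc_plus H A B C) = A \<oplus>\<^sub>o (B \<oplus>\<^sub>o C)"
  by (auto simp: assoc_plus_def)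

lemma assoc_plus_inverse:
  "inverse_arrows H (assoc_plus H A B C)
     (pair H (pair H (PrL H A (B \<oplus>\<^sub>o C)) (PrL H B C \<cdot> PrR H A (B \<oplus>\<^sub>o C))) (PrR H B C \<cdot> PrR H A (B \<oplus>\<^sub>o C)))"
  by (simp add: inverse_arrows_def assoc_plus_def pair_eta)

lemma iso_assoc_plus [simp]: "is_iso H (assoc_plus H A B C)"
  unfolding is_iso_def using assoc_plus_inverse by blast

lemma inv_assoc_plus: "inv_arr H (assoc_plus H A B C) =
     pair H (pair H (PrL H A (B \<oplus>\<^sub>o C)) (PrL H B C \<cdot> PrR H A (B \<oplus>\<^sub>o C))) (PrR H B C \<cdot> PrR H A (B \<oplus>\<^sub>o C))"
  by (rule inv_arr_eqI[OF assoc_plus_inverse])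

lemma Dom_sym_plus [simp]: "Dom H (sym_plus H A B) = A \<oplus>\<^sub>o B"
  and Cod_sym_plus [simp]: "Cod H (sym_plus H A B) = B \<oplus>\<^sub>o A"
  by (auto simp: sym_plus_def)

lemma iso_sym_plus [simp]: "is_iso H (sym_plus H A B)"
  by (rule is_isoI[of "sym_plus H B A"]) (auto simp: sym_plus_def)

lemma to_zero_in_hom: "to_zero H A \<in> hom H A (Zero H)"
  unfolding to_zero_def by (rule theI'[OF terminal])

lemma from_zero_in_hom: "from_zero H A \<in> hom H (Zero H) A"
  unfolding from_zero_def by (rule theI'[OF initial])

lemma Dom_to_zero [simp]: "Dom H (to_zero H A) = A" and Cod_to_zero [simp]: "Cod H (to_zero H A) = Zero H"
  and Dom_from_zero [simp]: "Dom H (from_zero H A) = Zero H" and Cod_from_zero [simp]: "Cod H (from_zero H A) = A"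
  and Dom_zero_arr [simp]: "Dom H (zero_arr H A B) = A" and Cod_zero_arr [simp]: "Cod H (zero_arr H A B) = B"
  using to_zero_in_hom[of A] from_zero_in_hom[of A] to_zero_in_hom[of B] from_zero_in_hom[of B]
  by (auto simp: hom_def zero_arr_def)

lemma to_zero_unique: "Dom H f = Dom H g \<Longrightarrow> Cod H f = Zero H \<Longrightarrow> Cod H g = Zero H \<Longrightarrow> f = g"
  using terminal[of "Dom H f"] by (auto simp: hom_def)

lemma from_zero_unique: "Cod H f = Cod H g \<Longrightarrow> Dom H f = Zero H \<Longrightarrow> Dom H g = Zero H \<Longrightarrow> f = g"
  using initial[of "Cod H f"] by (auto simp: hom_def)

lemma to_zero_Comp: "Cod H f = A \<Longrightarrow> to_zero H A \<cdot> f = to_zero H (Dom H f)"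
  by (rule to_zero_unique) auto

lemma Comp_from_zero: "Dom H f = A \<Longrightarrow> f \<cdot> from_zero H A = from_zero H (Cod H f)"
  by (rule from_zero_unique) auto

lemma zero_Comp [simp]: "Cod H f = A \<Longrightarrow> zero_arr H A B \<cdot> f = zero_arr H (Dom H f) B"
  by (simp add: zero_arr_def to_zero_Comp)

lemma Comp_zero [simp]: "Dom H f = B \<Longrightarrow> f \<cdot> zero_arr H A B = zero_arr H A (Cod H f)"
  by (simp add: zero_arr_def Comp_from_zero flip: Comp_assoc)

lemma iso_lunit_plus [simp]: "is_iso H (lunit_plus H A)"
proof (rule is_isoI[of "pair H (zero_arr H A (Zero H)) (Id H A)"])
  have *: "zero_arr H (Zero H \<oplus>\<^sub>o A) (Zero H) = PrL H (Zero H) A"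
    by (rule to_zero_unique) simp_all
  show "pair H (zero_arr H A (Zero H)) (Id H A) \<cdot> lunit_plus H A = Id H (Dom H (lunit_plus H A))"
    by (rule product_ext[where A = "Zero H" and B = A])
       (simp_all add: lunit_plus_def *)
qed (simp_all add: lunit_plus_def)

lemma iso_runit_plus [simp]: "is_iso H (runit_plus H A)"
proof (rule is_isoI[of "pair H (Id H A) (zero_arr H A (Zero H))"])
  have *: "zero_arr H (A \<oplus>\<^sub>o Zero H) (Zero H) = PrR H A (Zero H)"
    by (rule to_zero_unique) simp_all
  show "pair H (Id H A) (zero_arr H A (Zero H)) \<cdot> runit_plus H A = Id H (Dom H (runit_plus H A))"
    by (rule product_ext[where A = A and B = "Zero H"])
       (simp_all add: runit_plus_def *)
qed (simp_all add: runit_plus_def)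

lemma Dom_lunit_plus [simp]: "Dom H (lunit_plus H A) = Zero H \<oplus>\<^sub>o A"
  and Cod_lunit_plus [simp]: "Cod H (lunit_plus H A) = A"
  and Dom_runit_plus [simp]: "Dom H (runit_plus H A) = A \<oplus>\<^sub>o Zero H"
  and Cod_runit_plus [simp]: "Cod H (runit_plus H A) = A"
  by (auto simp: lunit_plus_def runit_plus_def)

lemma Plus1_faithful:
  assumes "Plus1 H f = Plus1 H g" "Dom H f = Dom H g" "Cod H f = Cod H g"
  shows "f = g"
proof -
  let ?T = "One H"
  have "PrL H (Cod H f) ?T \<cdot> Plus1 H f \<cdot> InL H (Dom H f) ?T = PrL H (Cod H f) ?T \<cdot> Plus1 H g \<cdot> InL H (Dom H f) ?T"
    using assms by simp
  then show ?thesis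
    using assms(2,3) by (simp add: Plus1_def PrL_plus_Comp PrL_InL)
qed

lemma copair_facts:
  assumes "Cod H f = Cod H g"
  shows "copair H f g \<in> hom H (Dom H f \<oplus>\<^sub>o Dom H g) (Cod H f) \<and>
    copair H f g \<cdot> InL H (Dom H f) (Dom H g) = f \<and> copair H f g \<cdot> InR H (Dom H f) (Dom H g) = g"
  unfolding copair_def
  by (rule theI', rule coproduct) (use assms in \<open>auto simp: hom_def\<close>)

lemma Dom_codiag [simp]: "Dom H (codiag H A) = A \<oplus>\<^sub>o A"
  and Cod_codiag [simp]: "Cod H (codiag H A) = A"
  and Dom_diag [simp]: "Dom H (diag H A) = A"
  and Cod_diag [simp]: "Cod H (diag H A) = A \<oplus>\<^sub>o A"
  using copair_facts[of "Id H A" "Id H A"] by (auto simp: codiag_def diag_def hom_def)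

end

section \<open>Coherence of \<open>\<otimes>\<close> and of \<open>expand\<close>\<close>

context distributive_category
begin

subsection \<open>Monoidal coherence\<close>

lemma Dom_Assoc [simp]: "Dom H (Assoc H A B C) = (A \<otimes>\<^sub>o B) \<otimes>\<^sub>o C"
  and Cod_Assoc [simp]: "Cod H (Assoc H A B C) = A \<otimes>\<^sub>o (B \<otimes>\<^sub>o C)"
  and Dom_LUnit [simp]: "Dom H (LUnit H A) = One H \<otimes>\<^sub>o A" and Cod_LUnit [simp]: "Cod H (LUnit H A) = A"
  and Dom_RUnit [simp]: "Dom H (RUnit H A) = A \<otimes>\<^sub>o One H" and Cod_RUnit [simp]: "Cod H (RUnit H A) = A"
  and Dom_Sym [simp]: "Dom H (Sym H A B) = A \<otimes>\<^sub>o B" and Cod_Sym [simp]: "Cod H (Sym H A B) = B \<otimes>\<^sub>o A"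
  using Assoc_in_hom LUnit_in_hom RUnit_in_hom Sym_in_hom by (auto simp: hom_def)

declare Tens_Id [simp] Assoc_iso [simp] LUnit_iso [simp] RUnit_iso [simp] distl_iso [simp]

lemma Tens_Tens [simp]: "Cod H f = Dom H g \<Longrightarrow> Cod H f' = Dom H g' \<Longrightarrow> (g \<otimes> g') \<cdot> (f \<otimes> f') = (g \<cdot> f) \<otimes> (g' \<cdot> f')"
  by (simp add: Tens_Comp)

lemma Tens_Tens_Comp [simp]: "Cod H f = Dom H g \<Longrightarrow> Cod H f' = Dom H g' \<Longrightarrow> Cod H h = Dom H f \<otimes>\<^sub>o Dom H f' \<Longrightarrow>
   (g \<otimes> g') \<cdot> (f \<otimes> f') \<cdot> h = ((g \<cdot> f) \<otimes> (g' \<cdot> f')) \<cdot> h"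
  by (simp flip: Comp_assoc)

lemma iso_Sym [simp]: "is_iso H (Sym H A B)"
  by (rule is_isoI[of "Sym H B A"]) (auto simp: Sym_Sym)

lemma iso_Tens [simp]: "is_iso H f \<Longrightarrow> is_iso H g \<Longrightarrow> is_iso H (f \<otimes> g)"
  by (rule is_isoI[of "inv_arr H f \<otimes> inv_arr H g"]) auto

lemma inv_Tens: "is_iso H f \<Longrightarrow> is_iso H g \<Longrightarrow> inv_arr H (f \<otimes> g) = inv_arr H f \<otimes> inv_arr H g"
  by (rule inv_arr_eqI) (auto simp: inverse_arrows_def)

lemma Assoc_nat' [simp]: "Cod H f = A \<Longrightarrow> Cod H g = B \<Longrightarrow> Cod H h = C \<Longrightarrow>
   Assoc H A B C \<cdot> ((f \<otimes> g) \<otimes> h) = (f \<otimes> (g \<otimes> h)) \<cdot> Assoc H (Dom H f) (Dom H g) (Dom H h)"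
  by (metis Assoc_natural)

lemma Assoc_nat'_Comp [simp]: "Cod H f = A \<Longrightarrow> Cod H g = B \<Longrightarrow> Cod H h = C \<Longrightarrow>
   Cod H k = (Dom H f \<otimes>\<^sub>o Dom H g) \<otimes>\<^sub>o Dom H h \<Longrightarrow>
   Assoc H A B C \<cdot> ((f \<otimes> g) \<otimes> h) \<cdot> k = (f \<otimes> (g \<otimes> h)) \<cdot> Assoc H (Dom H f) (Dom H g) (Dom H h) \<cdot> k"
  by (simp flip: Comp_assoc)

lemma LUnit_nat: "Cod H f = A \<Longrightarrow> LUnit H A \<cdot> (Id H (One H) \<otimes> f) = f \<cdot> LUnit H (Dom H f)"
  by (metis LUnit_natural)

lemma RUnit_nat: "Cod H f = A \<Longrightarrow> RUnit H A \<cdot> (f \<otimes> Id H (One H)) = f \<cdot> RUnit H (Dom H f)"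
  by (metis RUnit_natural)

lemma Sym_nat: "Cod H f = A \<Longrightarrow> Cod H g = B \<Longrightarrow> Sym H A B \<cdot> (f \<otimes> g) = (g \<otimes> f) \<cdot> Sym H (Dom H f) (Dom H g)"
  by (metis Sym_natural)

lemma Sym_nat_Comp: "Cod H f = A \<Longrightarrow> Cod H g = B \<Longrightarrow> Cod H h = Dom H f \<otimes>\<^sub>o Dom H g \<Longrightarrow>
   Sym H A B \<cdot> (f \<otimes> g) \<cdot> h = (g \<otimes> f) \<cdot> Sym H (Dom H f) (Dom H g) \<cdot> h"
  by (simp add: Sym_nat flip: Comp_assoc)

lemma One_Tens_faithful:
  assumes "Id H (One H) \<otimes> f = Id H (One H) \<otimes> g" "Dom H f = Dom H g" "Cod H f = Cod H g"
  shows "f = g"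
proof (rule iso_cancel_right[where p = "LUnit H (Dom H f)"])
  show "f \<cdot> LUnit H (Dom H f) = g \<cdot> LUnit H (Dom H f)"
    using assms LUnit_nat[of f "Cod H f"] LUnit_nat[of g "Cod H g"] by simp
qed (use assms in auto)

lemma Tens_One_faithful:
  assumes "f \<otimes> Id H (One H) = g \<otimes> Id H (One H)" "Dom H f = Dom H g" "Cod H f = Cod H g"
  shows "f = g"
proof (rule iso_cancel_right[where p = "RUnit H (Dom H f)"])
  show "f \<cdot> RUnit H (Dom H f) = g \<cdot> RUnit H (Dom H f)"
    using assms RUnit_nat[of f "Cod H f"] RUnit_nat[of g "Cod H g"] by simp
qed (use assms in auto)

lemma LUnit_Assoc: "LUnit H (A \<otimes>\<^sub>o B) \<cdot> Assoc H (One H) A B = LUnit H A \<otimes> Id H B"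
proof (rule One_Tens_faithful)
  let ?I = "Id H (One H)" and ?o = "One H"
  let ?p = "Assoc H ?o (?o \<otimes>\<^sub>o A) B \<cdot> (Assoc H ?o ?o A \<otimes> Id H B)"
  show "?I \<otimes> (LUnit H (A \<otimes>\<^sub>o B) \<cdot> Assoc H ?o A B) = ?I \<otimes> (LUnit H A \<otimes> Id H B)"
  proof (rule iso_cancel_right[where p = ?p])
    have "(?I \<otimes> (LUnit H (A \<otimes>\<^sub>o B) \<cdot> Assoc H ?o A B)) \<cdot> ?p
        = (?I \<otimes> LUnit H (A \<otimes>\<^sub>o B)) \<cdot> (?I \<otimes> Assoc H ?o A B) \<cdot> ?p"
      by simp
    also have "\<dots> = (?I \<otimes> LUnit H (A \<otimes>\<^sub>o B)) \<cdot> Assoc H ?o ?o (A \<otimes>\<^sub>o B) \<cdot> Assoc H (?o \<otimes>\<^sub>o ?o) A B"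
      by (simp only: pentagon)
    also have "\<dots> = (RUnit H ?o \<otimes> Id H (A \<otimes>\<^sub>o B)) \<cdot> Assoc H (?o \<otimes>\<^sub>o ?o) A B"
      by (simp flip: Comp_assoc triangle)
    also have "\<dots> = Assoc H ?o A B \<cdot> ((RUnit H ?o \<otimes> Id H A) \<otimes> Id H B)"
      by simp
    also have "\<dots> = Assoc H ?o A B \<cdot> (((?I \<otimes> LUnit H A) \<cdot> Assoc H ?o ?o A) \<otimes> (Id H B \<cdot> Id H B))"
      by (simp only: triangle) simp
    also have "\<dots> = Assoc H ?o A B \<cdot> ((?I \<otimes> LUnit H A) \<otimes> Id H B) \<cdot> (Assoc H ?o ?o A \<otimes> Id H B)"
      by (subst Tens_Comp) auto
    also have "\<dots> = (?I \<otimes> (LUnit H A \<otimes> Id H B)) \<cdot> ?p"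
      by (subst Assoc_nat'_Comp) auto
    finally show "(?I \<otimes> (LUnit H (A \<otimes>\<^sub>o B) \<cdot> Assoc H ?o A B)) \<cdot> ?p = (?I \<otimes> (LUnit H A \<otimes> Id H B)) \<cdot> ?p" .
  qed auto
qed auto

lemma RUnit_Assoc: "(Id H A \<otimes> RUnit H B) \<cdot> Assoc H A B (One H) = RUnit H (A \<otimes>\<^sub>o B)"
proof (rule Tens_One_faithful)
  let ?I = "Id H (One H)" and ?o = "One H"
  let ?f = "(Id H A \<otimes> RUnit H B) \<cdot> Assoc H A B ?o"
  show "?f \<otimes> ?I = RUnit H (A \<otimes>\<^sub>o B) \<otimes> ?I"
  proof (rule iso_cancel_left[where p = "Assoc H A B ?o"])
    have "Assoc H A B ?o \<cdot> (?f \<otimes> ?I) = Assoc H A B ?o \<cdot> ((Id H A \<otimes> RUnit H B) \<otimes> ?I) \<cdot> (Assoc H A B ?o \<otimes> ?I)"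
      by (subst Tens_Tens) auto
    also have "\<dots> = (Id H A \<otimes> (RUnit H B \<otimes> ?I)) \<cdot> Assoc H A (B \<otimes>\<^sub>o ?o) ?o \<cdot> (Assoc H A B ?o \<otimes> ?I)"
      by (subst Assoc_nat'_Comp) auto
    also have "\<dots> = (Id H A \<otimes> (Id H B \<otimes> LUnit H ?o)) \<cdot> (Id H A \<otimes> Assoc H B ?o ?o) \<cdot> Assoc H A (B \<otimes>\<^sub>o ?o) ?o \<cdot> (Assoc H A B ?o \<otimes> ?I)"
      by (simp flip: triangle)
    also have "\<dots> = (Id H A \<otimes> (Id H B \<otimes> LUnit H ?o)) \<cdot> Assoc H A B (?o \<otimes>\<^sub>o ?o) \<cdot> Assoc H (A \<otimes>\<^sub>o B) ?o ?o"
      by (simp only: pentagon)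
    also have "\<dots> = Assoc H A B ?o \<cdot> ((Id H A \<otimes> Id H B) \<otimes> LUnit H ?o) \<cdot> Assoc H (A \<otimes>\<^sub>o B) ?o ?o"
      by (subst Assoc_nat'_Comp) auto
    also have "\<dots> = Assoc H A B ?o \<cdot> (RUnit H (A \<otimes>\<^sub>o B) \<otimes> ?I)"
      by (simp add: triangle)
    finally show "Assoc H A B ?o \<cdot> (?f \<otimes> ?I) = Assoc H A B ?o \<cdot> (RUnit H (A \<otimes>\<^sub>o B) \<otimes> ?I)" .
  qed auto
qed auto

lemma LUnit_One: "LUnit H (One H) = RUnit H (One H)"
proof (rule Tens_One_faithful)
  let ?I = "Id H (One H)" and ?o = "One H"
  have "LUnit H (?o \<otimes>\<^sub>o ?o) = ?I \<otimes> LUnit H ?o"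
  proof (rule iso_cancel_left[where p = "LUnit H ?o"])
    show "LUnit H ?o \<cdot> LUnit H (?o \<otimes>\<^sub>o ?o) = LUnit H ?o \<cdot> (?I \<otimes> LUnit H ?o)"
      by (subst LUnit_nat) auto
  qed auto
  then show "LUnit H ?o \<otimes> ?I = RUnit H ?o \<otimes> ?I"
    using LUnit_Assoc[of ?o ?o] triangle[of ?o ?o] by simp
qed auto

lemma LUnit_Sym: "LUnit H A \<cdot> Sym H A (One H) = RUnit H A"
proof (rule Tens_One_faithful)
  let ?I = "Id H (One H)" and ?o = "One H"
  show "(LUnit H A \<cdot> Sym H A ?o) \<otimes> ?I = RUnit H A \<otimes> ?I"
  proof (rule iso_cancel_left[where p = "Sym H A ?o"])
    have "Sym H A ?o \<cdot> (RUnit H A \<otimes> ?I) = Sym H A ?o \<cdot> (Id H A \<otimes> LUnit H ?o) \<cdot> Assoc H A ?o ?o"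
      by (simp add: triangle)
    also have "\<dots> = (LUnit H ?o \<otimes> Id H A) \<cdot> Sym H A (?o \<otimes>\<^sub>o ?o) \<cdot> Assoc H A ?o ?o"
      by (subst Sym_nat_Comp) auto
    also have "\<dots> = LUnit H (?o \<otimes>\<^sub>o A) \<cdot> Assoc H ?o ?o A \<cdot> Sym H A (?o \<otimes>\<^sub>o ?o) \<cdot> Assoc H A ?o ?o"
      by (simp flip: LUnit_Assoc)
    also have "\<dots> = LUnit H (?o \<otimes>\<^sub>o A) \<cdot> (?I \<otimes> Sym H A ?o) \<cdot> Assoc H ?o A ?o \<cdot> (Sym H A ?o \<otimes> ?I)"
      by (simp only: hexagon)
    also have "\<dots> = (LUnit H (?o \<otimes>\<^sub>o A) \<cdot> (?I \<otimes> Sym H A ?o)) \<cdot> Assoc H ?o A ?o \<cdot> (Sym H A ?o \<otimes> ?I)"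
      by simp
    also have "\<dots> = Sym H A ?o \<cdot> (LUnit H (A \<otimes>\<^sub>o ?o) \<cdot> Assoc H ?o A ?o) \<cdot> (Sym H A ?o \<otimes> ?I)"
      by (subst LUnit_nat) auto
    also have "\<dots> = Sym H A ?o \<cdot> ((LUnit H A \<cdot> Sym H A ?o) \<otimes> ?I)"
      by (simp only: LUnit_Assoc) simp
    finally show "Sym H A ?o \<cdot> ((LUnit H A \<cdot> Sym H A ?o) \<otimes> ?I) = Sym H A ?o \<cdot> (RUnit H A \<otimes> ?I)" by simp
  qed auto
qed auto

lemma RUnit_Sym: "RUnit H A \<cdot> Sym H (One H) A = LUnit H A"
proof -
  have "LUnit H A \<cdot> Sym H A (One H) \<cdot> Sym H (One H) A = LUnit H A" by (simp add: Sym_Sym)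
  then show ?thesis using LUnit_Sym[of A] by (simp flip: Comp_assoc)
qed

subsection \<open>Distributors and \<open>expand\<close>\<close>

lemma Dom_distl [simp]: "Dom H (distl H A B C) = A \<otimes>\<^sub>o (B \<oplus>\<^sub>o C)"
  and Cod_distl [simp]: "Cod H (distl H A B C) = (A \<otimes>\<^sub>o B) \<oplus>\<^sub>o (A \<otimes>\<^sub>o C)"
  and Dom_distr [simp]: "Dom H (distr H A B C) = (A \<oplus>\<^sub>o B) \<otimes>\<^sub>o C"
  and Cod_distr [simp]: "Cod H (distr H A B C) = (A \<otimes>\<^sub>o C) \<oplus>\<^sub>o (B \<otimes>\<^sub>o C)"
  by (auto simp: distl_def distr_def)

lemma distr_eq: "distr H A B C = (Sym H C A \<oplus> Sym H C B) \<cdot> distl H C A B \<cdot> Sym H (A \<oplus>\<^sub>o B) C"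
proof -
  have "distl H C A B \<cdot> Sym H (A \<oplus>\<^sub>o B) C = pair H (Sym H A C \<cdot> (PrL H A B \<otimes> Id H C)) (Sym H B C \<cdot> (PrR H A B \<otimes> Id H C))"
    by (simp add: distl_def Sym_nat)
  then show ?thesis
    by (simp add: distr_def Sym_Sym flip: Comp_assoc)
qed

lemma iso_distr [simp]: "is_iso H (distr H A B C)"
  unfolding distr_eq by simp

lemma expand_eq: "expand H A B =
   pair H (pair H (PrL H A (One H) \<otimes> PrL H B (One H))
             (pair H (RUnit H A \<cdot> (PrL H A (One H) \<otimes> PrR H B (One H)))
                     (LUnit H B \<cdot> (PrR H A (One H) \<otimes> PrL H B (One H)))))
          (LUnit H (One H) \<cdot> (PrR H A (One H) \<otimes> PrR H B (One H)))"
  by (simp add: expand_def inv_assoc_plus distl_def distr_def) (simp add: assoc_plus_def)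

lemma Dom_expand [simp]: "Dom H (expand H A B) = Plus1O H A \<otimes>\<^sub>o Plus1O H B"
  and Cod_expand [simp]: "Cod H (expand H A B) = Plus1O H (A \<star>\<^sub>o B)"
  by (auto simp: expand_eq Plus1O_def BarO_def)

lemma iso_expand [simp]: "is_iso H (expand H A B)"
  by (simp add: expand_def)

lemma Dom_Bar [simp]: "Dom H (f \<star> g) = Dom H f \<star>\<^sub>o Dom H g"
  and Cod_Bar [simp]: "Cod H (f \<star> g) = Cod H f \<star>\<^sub>o Cod H g"
  and Dom_Plus1 [simp]: "Dom H (Plus1 H f) = Plus1O H (Dom H f)"
  and Cod_Plus1 [simp]: "Cod H (Plus1 H f) = Plus1O H (Cod H f)"
  by (auto simp: Bar_def BarO_def Plus1_def Plus1O_def)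

lemma Bar_Comp: "Cod H f = Dom H g \<Longrightarrow> Cod H f' = Dom H g' \<Longrightarrow> (g \<cdot> f) \<star> (g' \<cdot> f') = (g \<star> g') \<cdot> (f \<star> f')"
  by (simp add: Bar_def flip: plus_Comp)

lemma Bar_Id [simp]: "Id H A \<star> Id H B = Id H (A \<star>\<^sub>o B)"
  by (simp add: Bar_def BarO_def)

lemma iso_Bar [simp]: "is_iso H f \<Longrightarrow> is_iso H g \<Longrightarrow> is_iso H (f \<star> g)"
  by (simp add: Bar_def)

lemma Plus1_Comp: "Cod H f = Dom H g \<Longrightarrow> Plus1 H (g \<cdot> f) = Plus1 H g \<cdot> Plus1 H f"
  by (simp add: Plus1_def flip: plus_Comp)

lemma Plus1_Id [simp]: "Plus1 H (Id H A) = Id H (Plus1O H A)"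
  by (simp add: Plus1_def Plus1O_def)

lemma iso_Plus1 [simp]: "is_iso H f \<Longrightarrow> is_iso H (Plus1 H f)"
  by (simp add: Plus1_def)

lemma inv_Plus1: "is_iso H f \<Longrightarrow> Plus1 H (inv_arr H f) = inv_arr H (Plus1 H f)"
  by (simp add: Plus1_def inv_plus)

lemma LUnit_pull: "Cod H u = One H \<Longrightarrow> Cod H f = A \<Longrightarrow> Cod H k = Dom H f \<Longrightarrow>
    LUnit H A \<cdot> (u \<otimes> (f \<cdot> k)) = f \<cdot> LUnit H (Dom H f) \<cdot> (u \<otimes> k)"
proof -
  assume *: "Cod H u = One H" "Cod H f = A" "Cod H k = Dom H f"
  then have "LUnit H A \<cdot> (u \<otimes> (f \<cdot> k)) = (LUnit H A \<cdot> (Id H (One H) \<otimes> f)) \<cdot> (u \<otimes> k)"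
    by simp
  also have "\<dots> = f \<cdot> LUnit H (Dom H f) \<cdot> (u \<otimes> k)"
    using * by (subst LUnit_nat) auto
  finally show ?thesis .
qed

lemma RUnit_pull: "Cod H u = One H \<Longrightarrow> Cod H f = A \<Longrightarrow> Cod H k = Dom H f \<Longrightarrow>
    RUnit H A \<cdot> ((f \<cdot> k) \<otimes> u) = f \<cdot> RUnit H (Dom H f) \<cdot> (k \<otimes> u)"
proof -
  assume *: "Cod H u = One H" "Cod H f = A" "Cod H k = Dom H f"
  then have "RUnit H A \<cdot> ((f \<cdot> k) \<otimes> u) = (RUnit H A \<cdot> (f \<otimes> Id H (One H))) \<cdot> (k \<otimes> u)"
    by simp
  also have "\<dots> = f \<cdot> RUnit H (Dom H f) \<cdot> (k \<otimes> u)"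
    using * by (subst RUnit_nat) auto
  finally show ?thesis .
qed

lemma LUnit_PrL: "Cod H u = One H \<Longrightarrow> Cod H f = A \<oplus>\<^sub>o B \<Longrightarrow> PrL H A B \<cdot> LUnit H (A \<oplus>\<^sub>o B) \<cdot> (u \<otimes> f) = LUnit H A \<cdot> (u \<otimes> (PrL H A B \<cdot> f))"
  and LUnit_PrR: "Cod H u = One H \<Longrightarrow> Cod H f = A \<oplus>\<^sub>o B \<Longrightarrow> PrR H A B \<cdot> LUnit H (A \<oplus>\<^sub>o B) \<cdot> (u \<otimes> f) = LUnit H B \<cdot> (u \<otimes> (PrR H A B \<cdot> f))"
  and RUnit_PrL: "Cod H u = One H \<Longrightarrow> Cod H f = A \<oplus>\<^sub>o B \<Longrightarrow> PrL H A B \<cdot> RUnit H (A \<oplus>\<^sub>o B) \<cdot> (f \<otimes> u) = RUnit H A \<cdot> ((PrL H A B \<cdot> f) \<otimes> u)"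
  and RUnit_PrR: "Cod H u = One H \<Longrightarrow> Cod H f = A \<oplus>\<^sub>o B \<Longrightarrow> PrR H A B \<cdot> RUnit H (A \<oplus>\<^sub>o B) \<cdot> (f \<otimes> u) = RUnit H B \<cdot> ((PrR H A B \<cdot> f) \<otimes> u)"
  by (subst LUnit_pull RUnit_pull; simp)+

lemma expand_natural: "Plus1 H (f \<star> g) \<cdot> expand H (Dom H f) (Dom H g)
    = expand H (Cod H f) (Cod H g) \<cdot> (Plus1 H f \<otimes> Plus1 H g)"
  by (simp add: expand_eq Plus1_def Bar_def PrL_plus PrR_plus LUnit_pull[where f = g] RUnit_pull[where f = f])

lemma LUnit_pair: "Cod H u = One H \<Longrightarrow> Dom H f = Dom H g \<Longrightarrow> Cod H f = A \<Longrightarrow> Cod H g = B \<Longrightarrow>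
    LUnit H (A \<oplus>\<^sub>o B) \<cdot> (u \<otimes> pair H f g) = pair H (LUnit H A \<cdot> (u \<otimes> f)) (LUnit H B \<cdot> (u \<otimes> g))"
  by (rule product_ext[where A = A and B = B]) (auto simp: LUnit_PrL LUnit_PrR)

lemma LUnit_pair_Comp: "Cod H u = One H \<Longrightarrow> Dom H f = Dom H g \<Longrightarrow> Cod H f = A \<Longrightarrow> Cod H g = B \<Longrightarrow>
    Cod H h = Dom H u \<otimes>\<^sub>o Dom H f \<Longrightarrow> LUnit H (A \<oplus>\<^sub>o B) \<cdot> (u \<otimes> pair H f g) \<cdot> h =
    pair H (LUnit H A \<cdot> (u \<otimes> f) \<cdot> h) (LUnit H B \<cdot> (u \<otimes> g) \<cdot> h)"
  by (simp add: LUnit_pair flip: Comp_assoc)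

lemma RUnit_pair: "Cod H u = One H \<Longrightarrow> Dom H f = Dom H g \<Longrightarrow> Cod H f = A \<Longrightarrow> Cod H g = B \<Longrightarrow>
    RUnit H (A \<oplus>\<^sub>o B) \<cdot> (pair H f g \<otimes> u) = pair H (RUnit H A \<cdot> (f \<otimes> u)) (RUnit H B \<cdot> (g \<otimes> u))"
  by (rule product_ext[where A = A and B = B]) (auto simp: RUnit_PrL RUnit_PrR)

lemma Tens_Sym: "Dom H f = A \<Longrightarrow> Dom H g = B \<Longrightarrow> (g \<otimes> f) \<cdot> Sym H A B = Sym H (Cod H f) (Cod H g) \<cdot> (f \<otimes> g)"
  by (simp add: Sym_nat)

lemma LUnit_Sym_Comp: "Cod H h = A \<otimes>\<^sub>o One H \<Longrightarrow> LUnit H A \<cdot> Sym H A (One H) \<cdot> h = RUnit H A \<cdot> h"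
  and RUnit_Sym_Comp: "Cod H h = One H \<otimes>\<^sub>o A \<Longrightarrow> RUnit H A \<cdot> Sym H (One H) A \<cdot> h = LUnit H A \<cdot> h"
  using LUnit_Sym[of A] RUnit_Sym[of A] by (simp_all flip: Comp_assoc)

lemma Tens_RUnit_Assoc:
  "Cod H f = A \<Longrightarrow> Cod H g = B \<Longrightarrow> Cod H u = One H \<Longrightarrow> Dom H f = A' \<Longrightarrow> Dom H g = B' \<Longrightarrow> Dom H u = U' \<Longrightarrow>
   (f \<otimes> (RUnit H B \<cdot> (g \<otimes> u))) \<cdot> Assoc H A' B' U' = RUnit H (A \<otimes>\<^sub>o B) \<cdot> ((f \<otimes> g) \<otimes> u)"
proof -
  assume *: "Cod H f = A" "Cod H g = B" "Cod H u = One H" "Dom H f = A'" "Dom H g = B'" "Dom H u = U'"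
  then have "(f \<otimes> (RUnit H B \<cdot> (g \<otimes> u))) \<cdot> Assoc H A' B' U'
      = ((Id H A \<otimes> RUnit H B) \<cdot> Assoc H A B (One H)) \<cdot> ((f \<otimes> g) \<otimes> u)"
    by simp
  also have "\<dots> = RUnit H (A \<otimes>\<^sub>o B) \<cdot> ((f \<otimes> g) \<otimes> u)"
    unfolding RUnit_Assoc ..
  finally show ?thesis .
qed

lemma Tens_LUnit_Assoc:
  "Cod H f = A \<Longrightarrow> Cod H g = B \<Longrightarrow> Cod H u = One H \<Longrightarrow> Dom H f = A' \<Longrightarrow> Dom H g = B' \<Longrightarrow> Dom H u = U' \<Longrightarrow>
   (f \<otimes> (LUnit H B \<cdot> (u \<otimes> g))) \<cdot> Assoc H A' U' B' = (RUnit H A \<cdot> (f \<otimes> u)) \<otimes> g"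
proof -
  assume *: "Cod H f = A" "Cod H g = B" "Cod H u = One H" "Dom H f = A'" "Dom H g = B'" "Dom H u = U'"
  then have "(f \<otimes> (LUnit H B \<cdot> (u \<otimes> g))) \<cdot> Assoc H A' U' B'
      = ((Id H A \<otimes> LUnit H B) \<cdot> Assoc H A (One H) B) \<cdot> ((f \<otimes> u) \<otimes> g)"
    by simp
  also have "\<dots> = (RUnit H A \<cdot> (f \<otimes> u)) \<otimes> g"
    using * unfolding triangle by simp
  finally show ?thesis .
qed

lemma LUnit_Tens_Assoc:
  "Cod H f = A \<Longrightarrow> Cod H g = B \<Longrightarrow> Cod H u = One H \<Longrightarrow> Dom H f = A' \<Longrightarrow> Dom H g = B' \<Longrightarrow> Dom H u = U' \<Longrightarrow>
   LUnit H (A \<otimes>\<^sub>o B) \<cdot> (u \<otimes> (f \<otimes> g)) \<cdot> Assoc H U' A' B' = (LUnit H A \<cdot> (u \<otimes> f)) \<otimes> g"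
proof -
  assume *: "Cod H f = A" "Cod H g = B" "Cod H u = One H" "Dom H f = A'" "Dom H g = B'" "Dom H u = U'"
  then have "LUnit H (A \<otimes>\<^sub>o B) \<cdot> (u \<otimes> (f \<otimes> g)) \<cdot> Assoc H U' A' B'
      = (LUnit H (A \<otimes>\<^sub>o B) \<cdot> Assoc H (One H) A B) \<cdot> ((u \<otimes> f) \<otimes> g)"
    by simp
  also have "\<dots> = (LUnit H A \<cdot> (u \<otimes> f)) \<otimes> g"
    using * unfolding LUnit_Assoc by simp
  finally show ?thesis .
qed

lemma LUnit_RUnit: "Cod H v = One H \<Longrightarrow> Cod H k = One H \<otimes>\<^sub>o A \<Longrightarrow>
    LUnit H A \<cdot> RUnit H (One H \<otimes>\<^sub>o A) \<cdot> (k \<otimes> v) = RUnit H A \<cdot> ((LUnit H A \<cdot> k) \<otimes> v)"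
  by (subst RUnit_pull) auto

lemma expand_sym: "Plus1 H (sym_bar H A B) \<cdot> expand H A B = expand H B A \<cdot> Sym H (Plus1O H A) (Plus1O H B)"
  by (simp add: expand_eq Plus1_def Plus1O_def sym_bar_def sym_plus_def Tens_Sym LUnit_Sym_Comp RUnit_Sym_Comp
       LUnit_One)

lemma expand_runit: "Plus1 H (runit_bar H A) \<cdot> expand H A (Zero H) =
    RUnit H (Plus1O H A) \<cdot> (Id H (Plus1O H A) \<otimes> lunit_plus H (One H))"
  apply (rule product_ext[where A = A and B = "One H"])
     apply (simp_all add: expand_eq Plus1_def Plus1O_def runit_bar_def lunit_plus_def RUnit_PrL RUnit_PrR LUnit_One)
  done

lemma expand_lunit: "Plus1 H (lunit_bar H A) \<cdot> expand H (Zero H) A =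
    LUnit H (Plus1O H A) \<cdot> (lunit_plus H (One H) \<otimes> Id H (Plus1O H A))"
  apply (rule product_ext[where A = A and B = "One H"])
     apply (simp_all add: expand_eq Plus1_def Plus1O_def lunit_bar_def lunit_plus_def LUnit_PrL LUnit_PrR)
  done

lemma Dom_assoc_bar_parts [simp]:
  "Dom H (expand3l H A B C) = (A \<star>\<^sub>o B) \<star>\<^sub>o C" "Cod H (expand3l H A B C) = Dom H (match3 H A B C)"
  "Dom H (expand3r H A B C) = A \<star>\<^sub>o (B \<star>\<^sub>o C)" "Cod H (expand3r H A B C) = Cod H (match3 H A B C)"
  by (auto simp: expand3l_def expand3r_def match3_def BarO_def Let_def)

lemma iso_expand3l [simp]: "is_iso H (expand3l H A B C)"
  and iso_expand3r [simp]: "is_iso H (expand3r H A B C)"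
  by (simp_all add: expand3l_def expand3r_def BarO_def)

lemma Dom_assoc_bar [simp]: "Dom H (assoc_bar H A B C) = (A \<star>\<^sub>o B) \<star>\<^sub>o C"
  and Cod_assoc_bar [simp]: "Cod H (assoc_bar H A B C) = A \<star>\<^sub>o (B \<star>\<^sub>o C)"
  by (simp_all add: assoc_bar_def)

lemma expand_assoc:
  "Plus1 H (assoc_bar H A B C) \<cdot> expand H (A \<star>\<^sub>o B) C \<cdot> (expand H A B \<otimes> Id H (Plus1O H C))
   = expand H A (B \<star>\<^sub>o C) \<cdot> (Id H (Plus1O H A) \<otimes> expand H B C) \<cdot> Assoc H (Plus1O H A) (Plus1O H B) (Plus1O H C)"
  (is "_ \<cdot> ?l = ?r")
proof (rule iso_cancel_left[where p = "Plus1 H (expand3r H A B C)"])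
  have "Plus1 H (expand3r H A B C) \<cdot> Plus1 H (assoc_bar H A B C) \<cdot> ?l = Plus1 H (match3 H A B C \<cdot> expand3l H A B C) \<cdot> ?l"
    by (simp add: assoc_bar_def flip: Plus1_Comp Comp_assoc)
  also have "\<dots> = Plus1 H (expand3r H A B C) \<cdot> ?r"
    by (simp add: Plus1_def expand3r_def expand3l_def match3_def Let_def BarO_def expand_eq Plus1O_def
        distl_def distr_def LUnit_pair_Comp RUnit_pair Tens_RUnit_Assoc Tens_LUnit_Assoc LUnit_Tens_Assoc
        LUnit_RUnit LUnit_One[symmetric])
  finally show "Plus1 H (expand3r H A B C) \<cdot> Plus1 H (assoc_bar H A B C) \<cdot> ?l = Plus1 H (expand3r H A B C) \<cdot> ?r" .
qed simp_all

end

section \<open>Coherence of \<open>|\<close>\<close>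

context distributive_category
begin

subsection \<open>The rebracketings \<open>merge\<close>\<close>

lemma iso_Comp_reflect:
  assumes "is_iso H (p \<cdot> e)" "is_iso H e" "Cod H e = Dom H p"
  shows "is_iso H p"
proof -
  have "p = (p \<cdot> e) \<cdot> inv_arr H e" using assms(2,3) by simp
  moreover have "is_iso H ((p \<cdot> e) \<cdot> inv_arr H e)"
    by (rule iso_Comp) (use assms in auto)
  ultimately show ?thesis by metis
qed

lemma Plus1_InL: "Plus1 H f \<cdot> InL H (Dom H f) (One H) = InL H (Cod H f) (One H) \<cdot> f"
  by (rule product_ext[where A = "Cod H f" and B = "One H"])
     (simp_all add: Plus1_def PrL_plus_Comp PrR_plus_Comp PrL_InL PrR_InL,
      simp_all add: PrL_InL PrR_InL flip: Comp_assoc)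

lemma Plus1_reflects_iso:
  assumes "is_iso H (Plus1 H f)"
  shows "is_iso H f"
proof -
  let ?h = "inv_arr H (Plus1 H f)" and ?A = "Dom H f" and ?B = "Cod H f" and ?o = "One H"
  let ?g = "PrL H ?A ?o \<cdot> ?h \<cdot> InL H ?B ?o"
  have h: "Dom H ?h = ?B \<oplus>\<^sub>o ?o" "Cod H ?h = ?A \<oplus>\<^sub>o ?o" using assms by (simp_all add: Plus1O_def)
  have "f \<cdot> ?g = (f \<cdot> PrL H ?A ?o) \<cdot> ?h \<cdot> InL H ?B ?o" using h by simp
  also have "\<dots> = PrL H ?B ?o \<cdot> (Plus1 H f \<cdot> ?h) \<cdot> InL H ?B ?o"
    using h by (simp add: Plus1_def PrL_plus_Comp)
  also have "\<dots> = Id H ?B" using assms by (simp add: PrL_InL Plus1O_def)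
  finally have 1: "f \<cdot> ?g = Id H ?B" .
  have "?g \<cdot> f = PrL H ?A ?o \<cdot> ?h \<cdot> (InL H ?B ?o \<cdot> f)" using h by simp
  also have "\<dots> = PrL H ?A ?o \<cdot> (?h \<cdot> Plus1 H f) \<cdot> InL H ?A ?o"
    using h by (simp add: Plus1O_def flip: Plus1_InL)
  also have "\<dots> = Id H ?A" using assms by (simp add: PrL_InL Plus1O_def)
  finally have 2: "?g \<cdot> f = Id H ?A" .
  show ?thesis by (rule is_isoI[OF _ _ 2 1]) (use h in simp_all)
qed

lemma Dom_lunit_bar [simp]: "Dom H (lunit_bar H A) = Zero H \<star>\<^sub>o A"
  and Cod_lunit_bar [simp]: "Cod H (lunit_bar H A) = A"
  and Dom_runit_bar [simp]: "Dom H (runit_bar H A) = A \<star>\<^sub>o Zero H"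
  and Cod_runit_bar [simp]: "Cod H (runit_bar H A) = A"
  and Dom_sym_bar [simp]: "Dom H (sym_bar H A B) = A \<star>\<^sub>o B"
  and Cod_sym_bar [simp]: "Cod H (sym_bar H A B) = B \<star>\<^sub>o A"
  by (auto simp: lunit_bar_def runit_bar_def sym_bar_def BarO_def)

lemma Plus1O_Zero: "Plus1O H (Zero H) = Zero H \<oplus>\<^sub>o One H"
  by (simp add: Plus1O_def)

lemma iso_lunit_bar [simp]: "is_iso H (lunit_bar H A)"
proof (rule Plus1_reflects_iso, rule iso_Comp_reflect[where e = "expand H (Zero H) A"])
  show "is_iso H (Plus1 H (lunit_bar H A) \<cdot> expand H (Zero H) A)"
    unfolding expand_lunit by simp
qed auto

lemma iso_runit_bar [simp]: "is_iso H (runit_bar H A)"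
proof (rule Plus1_reflects_iso, rule iso_Comp_reflect[where e = "expand H A (Zero H)"])
  show "is_iso H (Plus1 H (runit_bar H A) \<cdot> expand H A (Zero H))"
    unfolding expand_runit by simp
qed auto

lemma iso_assoc_bar [simp]: "is_iso H (assoc_bar H A B C)"
proof (rule Plus1_reflects_iso, rule iso_Comp_reflect[where e = "expand H (A \<star>\<^sub>o B) C \<cdot> (expand H A B \<otimes> Id H (Plus1O H C))"])
  show "is_iso H (Plus1 H (assoc_bar H A B C) \<cdot> expand H (A \<star>\<^sub>o B) C \<cdot> (expand H A B \<otimes> Id H (Plus1O H C)))"
    unfolding expand_assoc by simp
qed auto

lemma iso_sym_bar [simp]: "is_iso H (sym_bar H A B)"
  by (simp add: sym_bar_def)

lemma osem_snoc: "osem H (X @ [B]) = (if X = [] then csem H B else osem H X \<star>\<^sub>o csem H B)"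
  by (cases X) auto

lemma merge_Nil: "merge H X [] = runit_bar H (osem H X)"
  by (simp add: merge_def)

lemma merge_single: "merge H X [B] = (if X = [] then lunit_bar H (csem H B) else Id H (osem H X \<star>\<^sub>o csem H B))"
  by (simp add: merge_def)

lemma merge_snoc: "Y \<noteq> [] \<Longrightarrow> merge H X (Y @ [B]) =
    (merge H X Y \<star> Id H (csem H B)) \<cdot> inv_arr H (assoc_bar H (osem H X) (osem H Y) (csem H B))"
  by (cases Y rule: rev_cases) (auto simp: merge_def)

lemma merge_facts: "Dom H (merge H X Y) = osem H X \<star>\<^sub>o osem H Y \<and> Cod H (merge H X Y) = osem H (X @ Y)
    \<and> is_iso H (merge H X Y)"
proof (induction Y rule: rev_induct)
  case Nil
  show ?case by (simp add: merge_Nil)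
next
  case (snoc B Y)
  show ?case
  proof (cases "Y = []")
    case True
    then show ?thesis by (simp add: merge_single osem_snoc)
  next
    case False
    then show ?thesis using snoc osem_snoc[of "X @ Y" B] osem_snoc[of Y B] by (simp add: merge_snoc)
  qed
qed

lemma Dom_merge [simp]: "Dom H (merge H X Y) = osem H X \<star>\<^sub>o osem H Y"
  and Cod_merge [simp]: "Cod H (merge H X Y) = osem H (X @ Y)"
  and iso_merge [simp]: "is_iso H (merge H X Y)"
  using merge_facts by auto

text \<open>\<open>phi X Y\<close> is the comparison isomorphism by which the parallel composition of full diagrams
  is transported to \<open>\<otimes>\<close>; it is associative, unital and symmetric.\<close>

definition osem1 :: "colour list \<Rightarrow> 'o" where "osem1 X = Plus1O H (osem H X)"

definition phi :: "colour list \<Rightarrow> colour list \<Rightarrow> 'm" where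
  "phi X Y = Plus1 H (merge H X Y) \<cdot> expand H (osem H X) (osem H Y)"

definition psi :: "colour list \<Rightarrow> colour \<Rightarrow> 'm" where
  "psi Y B = (if Y = [] then LUnit H (osem1 [B]) \<cdot> (lunit_plus H (One H) \<otimes> Id H (osem1 [B]))
              else expand H (osem H Y) (csem H B))"

lemma osem1_Nil: "osem1 [] = Zero H \<oplus>\<^sub>o One H"
  by (simp add: osem1_def Plus1O_def)

lemma phi_typing [simp]: "Dom H (phi X Y) = osem1 X \<otimes>\<^sub>o osem1 Y" "Cod H (phi X Y) = osem1 (X @ Y)" "is_iso H (phi X Y)"
  by (simp_all add: phi_def osem1_def)

lemma psi_typing [simp]: "Dom H (psi Y B) = osem1 Y \<otimes>\<^sub>o osem1 [B]" "Cod H (psi Y B) = osem1 (Y @ [B])" "is_iso H (psi Y B)"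
  by (auto simp: psi_def osem1_def osem_snoc Plus1O_Zero)

lemma phi_Nil_right: "phi X [] = RUnit H (osem1 X) \<cdot> (Id H (osem1 X) \<otimes> lunit_plus H (One H))"
  by (simp add: phi_def merge_Nil expand_runit osem1_def)

lemma phi_single: "phi X [B] = psi X B"
  by (simp add: phi_def psi_def merge_single expand_lunit osem1_def)

lemma phi_snoc: "phi X (Y @ [B]) \<cdot> (Id H (osem1 X) \<otimes> psi Y B) \<cdot> Assoc H (osem1 X) (osem1 Y) (osem1 [B])
    = psi (X @ Y) B \<cdot> (phi X Y \<otimes> Id H (osem1 [B]))"
proof (cases "Y = []")
  case True
  then show ?thesis
    by (simp add: phi_single phi_Nil_right psi_def[of "[]"]) (simp add: Tens_LUnit_Assoc osem1_Nil)
next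
  case False
  let ?X = "osem H X" and ?Y = "osem H Y" and ?B = "csem H B"
  let ?a = "assoc_bar H ?X ?Y ?B"
  have "phi X (Y @ [B]) \<cdot> (Id H (osem1 X) \<otimes> psi Y B) \<cdot> Assoc H (osem1 X) (osem1 Y) (osem1 [B])
     = Plus1 H (merge H X Y \<star> Id H ?B) \<cdot> Plus1 H (inv_arr H ?a) \<cdot> expand H ?X (?Y \<star>\<^sub>o ?B)
       \<cdot> (Id H (Plus1O H ?X) \<otimes> expand H ?Y ?B) \<cdot> Assoc H (Plus1O H ?X) (Plus1O H ?Y) (Plus1O H ?B)"
    using False by (simp add: phi_def merge_snoc psi_def osem1_def osem_snoc Plus1_Comp)
  also have "\<dots> = Plus1 H (merge H X Y \<star> Id H ?B) \<cdot> Plus1 H (inv_arr H ?a) \<cdot> Plus1 H ?a \<cdot>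
      expand H (?X \<star>\<^sub>o ?Y) ?B \<cdot> (expand H ?X ?Y \<otimes> Id H (Plus1O H ?B))"
    by (simp only: expand_assoc)
  also have "\<dots> = (Plus1 H (merge H X Y \<star> Id H ?B) \<cdot> expand H (?X \<star>\<^sub>o ?Y) ?B) \<cdot> (expand H ?X ?Y \<otimes> Id H (Plus1O H ?B))"
    by (simp add: inv_Plus1)
  also have "\<dots> = psi (X @ Y) B \<cdot> (phi X Y \<otimes> Id H (osem1 [B]))"
    using expand_natural[of "merge H X Y" "Id H ?B"] False
    by (simp add: psi_def phi_def osem1_def)
  finally show ?thesis .
qed

lemma phi_assoc: "phi X (Y @ Z) \<cdot> (Id H (osem1 X) \<otimes> phi Y Z) \<cdot> Assoc H (osem1 X) (osem1 Y) (osem1 Z)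
    = phi (X @ Y) Z \<cdot> (phi X Y \<otimes> Id H (osem1 Z))"
proof (induction Z rule: rev_induct)
  case Nil
  show ?case
    using RUnit_pull[of "lunit_plus H (One H)" "phi X Y" _ "Id H (osem1 X \<otimes>\<^sub>o osem1 Y)"]
    by (simp add: phi_Nil_right Tens_RUnit_Assoc osem1_Nil)
next
  case (snoc B Z)
  let ?X = "osem1 X" and ?Y = "osem1 Y" and ?Z = "osem1 Z" and ?B = "osem1 [B]"
  let ?p = "(Id H (?X \<otimes>\<^sub>o ?Y) \<otimes> psi Z B) \<cdot> Assoc H (?X \<otimes>\<^sub>o ?Y) ?Z ?B"
  show ?case
  proof (rule iso_cancel_right[where p = ?p])
    have "(phi X (Y @ Z @ [B]) \<cdot> (Id H ?X \<otimes> phi Y (Z @ [B])) \<cdot> Assoc H ?X ?Y (osem1 (Z @ [B]))) \<cdot> ?p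
      = phi X (Y @ Z @ [B]) \<cdot> (Id H ?X \<otimes> phi Y (Z @ [B])) \<cdot>
         (Assoc H ?X ?Y (osem1 (Z @ [B])) \<cdot> ((Id H ?X \<otimes> Id H ?Y) \<otimes> psi Z B)) \<cdot> Assoc H (?X \<otimes>\<^sub>o ?Y) ?Z ?B"
      by (simp del: Assoc_nat' Assoc_nat'_Comp)
    also have "\<dots> = phi X (Y @ Z @ [B]) \<cdot> (Id H ?X \<otimes> (phi Y (Z @ [B]) \<cdot> (Id H ?Y \<otimes> psi Z B))) \<cdot>
         Assoc H ?X ?Y (?Z \<otimes>\<^sub>o ?B) \<cdot> Assoc H (?X \<otimes>\<^sub>o ?Y) ?Z ?B"
      by (subst Assoc_nat') (simp_all)
    also have "\<dots> = phi X (Y @ Z @ [B]) \<cdot> (Id H ?X \<otimes> (phi Y (Z @ [B]) \<cdot> (Id H ?Y \<otimes> psi Z B))) \<cdot>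
         (Id H ?X \<otimes> Assoc H ?Y ?Z ?B) \<cdot> Assoc H ?X (?Y \<otimes>\<^sub>o ?Z) ?B \<cdot> (Assoc H ?X ?Y ?Z \<otimes> Id H ?B)"
      by (simp only: pentagon)
    also have "\<dots> = phi X (Y @ Z @ [B]) \<cdot> (Id H ?X \<otimes> (phi Y (Z @ [B]) \<cdot> (Id H ?Y \<otimes> psi Z B) \<cdot> Assoc H ?Y ?Z ?B))
         \<cdot> Assoc H ?X (?Y \<otimes>\<^sub>o ?Z) ?B \<cdot> (Assoc H ?X ?Y ?Z \<otimes> Id H ?B)"
      by simp
    also have "\<dots> = phi X (Y @ Z @ [B]) \<cdot> (Id H ?X \<otimes> (psi (Y @ Z) B \<cdot> (phi Y Z \<otimes> Id H ?B)))
         \<cdot> Assoc H ?X (?Y \<otimes>\<^sub>o ?Z) ?B \<cdot> (Assoc H ?X ?Y ?Z \<otimes> Id H ?B)"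
      by (simp only: phi_snoc)
    also have "\<dots> = phi X ((Y @ Z) @ [B]) \<cdot> (Id H ?X \<otimes> psi (Y @ Z) B) \<cdot> (Id H ?X \<otimes> (phi Y Z \<otimes> Id H ?B))
         \<cdot> Assoc H ?X (?Y \<otimes>\<^sub>o ?Z) ?B \<cdot> (Assoc H ?X ?Y ?Z \<otimes> Id H ?B)"
      by simp
    also have "\<dots> = (phi X ((Y @ Z) @ [B]) \<cdot> (Id H ?X \<otimes> psi (Y @ Z) B) \<cdot> Assoc H ?X (osem1 (Y @ Z)) ?B)
         \<cdot> ((Id H ?X \<otimes> phi Y Z) \<otimes> Id H ?B) \<cdot> (Assoc H ?X ?Y ?Z \<otimes> Id H ?B)"
      by (simp del: Tens_Tens Tens_Tens_Comp)
    also have "\<dots> = psi (X @ Y @ Z) B \<cdot> ((phi X (Y @ Z) \<cdot> (Id H ?X \<otimes> phi Y Z) \<cdot> Assoc H ?X ?Y ?Z) \<otimes> Id H ?B)"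
      unfolding phi_snoc by simp
    also have "\<dots> = psi (X @ Y @ Z) B \<cdot> ((phi (X @ Y) Z \<cdot> (phi X Y \<otimes> Id H ?Z)) \<otimes> Id H ?B)"
      by (simp only: snoc)
    also have "\<dots> = (psi ((X @ Y) @ Z) B \<cdot> (phi (X @ Y) Z \<otimes> Id H ?B)) \<cdot> ((phi X Y \<otimes> Id H ?Z) \<otimes> Id H ?B)"
      by simp
    also have "\<dots> = (phi (X @ Y) (Z @ [B]) \<cdot> (Id H (osem1 (X @ Y)) \<otimes> psi Z B) \<cdot> Assoc H (osem1 (X @ Y)) ?Z ?B) \<cdot> ((phi X Y \<otimes> Id H ?Z) \<otimes> Id H ?B)"
      unfolding phi_snoc ..
    also have "\<dots> = (phi (X @ Y) (Z @ [B]) \<cdot> (phi X Y \<otimes> Id H (osem1 (Z @ [B])))) \<cdot> ?p"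
      by simp
    finally show "(phi X (Y @ Z @ [B]) \<cdot> (Id H ?X \<otimes> phi Y (Z @ [B])) \<cdot> Assoc H ?X ?Y (osem1 (Z @ [B]))) \<cdot> ?p
      = (phi (X @ Y) (Z @ [B]) \<cdot> (phi X Y \<otimes> Id H (osem1 (Z @ [B])))) \<cdot> ?p" .
  qed simp_all
qed

lemma phi_Nil_left: "phi [] Y = LUnit H (osem1 Y) \<cdot> (lunit_plus H (One H) \<otimes> Id H (osem1 Y))"
proof (induction Y rule: rev_induct)
  case Nil
  let ?u = "lunit_plus H (One H)"
  show ?case
  proof (rule iso_cancel_left[where p = ?u])
    have "?u \<cdot> phi [] [] = RUnit H (One H) \<cdot> (?u \<otimes> ?u)"
      using RUnit_pull[of ?u ?u _ "Id H (osem1 [])"] by (simp add: phi_Nil_right osem1_Nil)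
    moreover have "?u \<cdot> LUnit H (osem1 []) \<cdot> (?u \<otimes> Id H (osem1 [])) = LUnit H (One H) \<cdot> (?u \<otimes> ?u)"
      using LUnit_pull[of ?u ?u _ "Id H (osem1 [])"] by (simp add: osem1_Nil)
    ultimately show "?u \<cdot> phi [] [] = ?u \<cdot> LUnit H (osem1 []) \<cdot> (?u \<otimes> Id H (osem1 []))"
      by (simp add: LUnit_One)
  qed (simp_all add: osem1_Nil)
next
  case (snoc B Y)
  let ?u = "lunit_plus H (One H)" and ?Y = "osem1 Y" and ?B = "osem1 [B]"
  let ?p = "(Id H (osem1 []) \<otimes> psi Y B) \<cdot> Assoc H (osem1 []) ?Y ?B"
  show ?case
  proof (rule iso_cancel_right[where p = ?p])
    have "phi [] (Y @ [B]) \<cdot> ?p = psi Y B \<cdot> ((LUnit H ?Y \<cdot> (?u \<otimes> Id H ?Y)) \<otimes> Id H ?B)"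
      using phi_snoc[of "[]" Y B] snoc by simp
    also have "\<dots> = psi Y B \<cdot> LUnit H (?Y \<otimes>\<^sub>o ?B) \<cdot> (?u \<otimes> (Id H ?Y \<otimes> Id H ?B)) \<cdot> Assoc H (osem1 []) ?Y ?B"
      by (subst LUnit_Tens_Assoc) (simp_all add: osem1_Nil)
    also have "\<dots> = (psi Y B \<cdot> LUnit H (?Y \<otimes>\<^sub>o ?B) \<cdot> (?u \<otimes> Id H (?Y \<otimes>\<^sub>o ?B))) \<cdot> Assoc H (osem1 []) ?Y ?B"
      by (simp add: osem1_Nil)
    also have "\<dots> = (LUnit H (osem1 (Y @ [B])) \<cdot> (?u \<otimes> (psi Y B \<cdot> Id H (?Y \<otimes>\<^sub>o ?B)))) \<cdot> Assoc H (osem1 []) ?Y ?B"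
      by (subst LUnit_pull) simp_all
    also have "\<dots> = (LUnit H (osem1 (Y @ [B])) \<cdot> (?u \<otimes> Id H (osem1 (Y @ [B])))) \<cdot> ?p"
      by (simp add: osem1_Nil)
    finally show "phi [] (Y @ [B]) \<cdot> ?p = (LUnit H (osem1 (Y @ [B])) \<cdot> (?u \<otimes> Id H (osem1 (Y @ [B])))) \<cdot> ?p" .
  qed (simp_all add: osem1_Nil)
qed

lemma Dom_swap_sem [simp]: "Dom H (swap_sem H X Y) = osem H (X @ Y)"
  and Cod_swap_sem [simp]: "Cod H (swap_sem H X Y) = osem H (Y @ X)"
  by (simp_all add: swap_sem_def)

lemma Plus1_swap_sem: "Plus1 H (swap_sem H X Y) = phi Y X \<cdot> Sym H (osem1 X) (osem1 Y) \<cdot> inv_arr H (phi X Y)"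
proof (rule iso_cancel_right[where p = "phi X Y"])
  have "Plus1 H (swap_sem H X Y) \<cdot> phi X Y =
     Plus1 H (merge H Y X) \<cdot> Plus1 H (sym_bar H (osem H X) (osem H Y)) \<cdot> expand H (osem H X) (osem H Y)"
    by (simp add: swap_sem_def phi_def Plus1_Comp inv_Plus1)
  also have "\<dots> = phi Y X \<cdot> Sym H (osem1 X) (osem1 Y)"
    by (simp add: expand_sym phi_def osem1_def)
  finally show "Plus1 H (swap_sem H X Y) \<cdot> phi X Y = (phi Y X \<cdot> Sym H (osem1 X) (osem1 Y) \<cdot> inv_arr H (phi X Y)) \<cdot> phi X Y"
    by simp
qed (simp_all add: osem1_def)

end

section \<open>Well-definedness of the semantics\<close>

context distributive_category
begin

subsection \<open>Typing of the semantics\<close>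

lemma canonical_ceq: "canonical H A B f \<Longrightarrow> A \<approx> B"
  by (induction rule: canonical.induct) (blast intro: ceq.intros)+

lemma canonical_typing: "canonical H A B f \<Longrightarrow> Dom H f = csem H A \<and> Cod H f = csem H B \<and> is_iso H f"
  by (induction rule: canonical.induct) auto

lemma canonical_exists: "A \<approx> B \<Longrightarrow> \<exists>f. canonical H A B f"
  by (induction rule: ceq.induct) (blast intro: canonical.intros)+

lemma adapter_canonical: "A \<approx> B \<Longrightarrow> canonical H A B (adapter H A B)"
  unfolding adapter_def using canonical_exists by (rule someI_ex)

lemma adapter_typing [simp]:
  assumes "A \<approx> B"
  shows "Dom H (adapter H A B) = csem H A" "Cod H (adapter H A B) = csem H B" "is_iso H (adapter H A B)"
  using canonical_typing[OF adapter_canonical[OF assms]] by auto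

end

context tp_model
begin

lemma scal_typing [simp]: "Dom H (scal s) = One H" "Cod H (scal s) = One H"
  using scal_bij by (auto simp: bij_betw_def hom_def)

lemma smult_typing [simp]: "Dom H (smult H scal s f) = Dom H f" "Cod H (smult H scal s f) = Cod H f"
  by (simp_all add: smult_def)

lemma fgen_sem_typing:
  "fgen_ok g \<Longrightarrow> Dom H (fgen_sem H scal g) = osem H (fgen_dom g) \<and> Cod H (fgen_sem H scal g) = osem H (fgen_cod g)"
  by (cases g) (auto simp: BarO_def)

lemma fsem_typing:
  "twf fgen_dom fgen_cod fgen_ok d \<Longrightarrow>
   Dom H (fsem H scal d) = osem H (tdom fgen_dom d) \<and> Cod H (fsem H scal d) = osem H (tcod fgen_cod d)"
  by (induction d) (auto simp: fgen_sem_typing)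

lemma gen_sem_typing:
  "gen_ok g \<Longrightarrow> Dom H (gen_sem H scal g) = osem1 (gen_dom g) \<and> Cod H (gen_sem H scal g) = osem1 (gen_cod g)"
  by (cases g) (auto simp: fgen_sem_typing osem1_def Plus1O_def)

lemma sem_TPar:
  assumes "Dom H (sem H scal d) = osem1 (tdom gen_dom d)" "Cod H (sem H scal d) = osem1 (tcod gen_cod d)"
    and "Dom H (sem H scal e) = osem1 (tdom gen_dom e)" "Cod H (sem H scal e) = osem1 (tcod gen_cod e)"
  shows "sem H scal (TPar d e) = phi (tcod gen_cod d) (tcod gen_cod e) \<cdot> (sem H scal d \<otimes> sem H scal e)
     \<cdot> inv_arr H (phi (tdom gen_dom d) (tdom gen_dom e))"
  using assms by (simp add: phi_def inv_of_Comp inv_Plus1 osem1_def)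

lemma sem_typing:
  "twf gen_dom gen_cod gen_ok d \<Longrightarrow>
   Dom H (sem H scal d) = osem1 (tdom gen_dom d) \<and> Cod H (sem H scal d) = osem1 (tcod gen_cod d)"
proof (induction d)
  case (TPar d e)
  then show ?case using sem_TPar[of d e] by (simp del: sem.simps)
qed (auto simp: gen_sem_typing osem1_def)

lemma sem_functional:
  "twf fgen_dom fgen_cod fgen_ok d \<Longrightarrow> sem H scal (map_pterm Fun d) = Plus1 H (fsem H scal d)"
proof (induction d)
  case (TPar d e)
  have [simp]: "tdom gen_dom (map_pterm Fun k) = tdom fgen_dom k" "tcod gen_cod (map_pterm Fun k) = tcod fgen_cod k" for k :: "'r fgen pterm"
    by (induction k) auto
  note tps = fsem_typing[of d] fsem_typing[of e]
  let ?E = "expand H (osem H (tdom fgen_dom d)) (osem H (tdom fgen_dom e))"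
    and ?E' = "expand H (osem H (tcod fgen_cod d)) (osem H (tcod fgen_cod e))"
    and ?f = "fsem H scal d" and ?g = "fsem H scal e"
  have *: "?E' \<cdot> (Plus1 H ?f \<otimes> Plus1 H ?g) \<cdot> inv_arr H ?E \<cdot> h = Plus1 H (?f \<star> ?g) \<cdot> h"
    if "Cod H h = Plus1O H (Dom H ?f \<star>\<^sub>o Dom H ?g)" for h
  proof -
    have "?E' \<cdot> (Plus1 H ?f \<otimes> Plus1 H ?g) \<cdot> inv_arr H ?E \<cdot> h
        = (?E' \<cdot> (Plus1 H ?f \<otimes> Plus1 H ?g)) \<cdot> inv_arr H ?E \<cdot> h"
      using that TPar tps by simp
    also have "\<dots> = (Plus1 H (?f \<star> ?g) \<cdot> ?E) \<cdot> inv_arr H ?E \<cdot> h"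
      using TPar tps expand_natural[of ?f ?g] by simp
    also have "\<dots> = Plus1 H (?f \<star> ?g) \<cdot> h"
      using that TPar tps by simp
    finally show ?thesis .
  qed
  show ?case
    using TPar tps by (simp add: * Plus1_Comp)
next
  case (TSeq e d)
  then show ?case using fsem_typing[of e] fsem_typing[of d] by (simp add: Plus1_Comp)
qed auto

subsection \<open>The semantics respects the equations of a PROP\<close>

abbreviation "gwf \<equiv> twf gen_dom gen_cod gen_ok"
abbreviation "gdom \<equiv> tdom gen_dom"
abbreviation "gcod \<equiv> tcod gen_cod"
abbreviation "tsem \<equiv> sem H scal"

lemma S_Dom: "gwf d \<Longrightarrow> Dom H (tsem d) = osem1 (gdom d)" and S_Cod: "gwf d \<Longrightarrow> Cod H (tsem d) = osem1 (gcod d)"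
  using sem_typing by auto

lemma S_par: "gwf d \<Longrightarrow> gwf e \<Longrightarrow> tsem (TPar d e) = phi (gcod d) (gcod e) \<cdot> (tsem d \<otimes> tsem e) \<cdot> inv_arr H (phi (gdom d) (gdom e))"
  by (rule sem_TPar) (auto simp: S_Dom S_Cod)

lemma S_par_phi: "gwf d \<Longrightarrow> gwf e \<Longrightarrow> tsem (TPar d e) \<cdot> phi (gdom d) (gdom e) = phi (gcod d) (gcod e) \<cdot> (tsem d \<otimes> tsem e)"
  by (simp add: S_par S_Dom S_Cod del: sem.simps)

lemma S_swap: "tsem (TSwap X Y) = phi Y X \<cdot> Sym H (osem1 X) (osem1 Y) \<cdot> inv_arr H (phi X Y)"
  by (simp add: Plus1_swap_sem)

lemma S_id: "tsem (TId X) = Id H (osem1 X)"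
  by (simp add: osem1_def)

lemma peq_typing: "peq D C ok d e \<Longrightarrow> twf D C ok d \<and> twf D C ok e \<and> tdom D d = tdom D e \<and> tcod C d = tcod C e"
  by (induction rule: peq.induct) auto

lemma S_par_assoc:
  assumes "gwf d" "gwf e" "gwf k"
  shows "tsem (TPar (TPar d e) k) = tsem (TPar d (TPar e k))"
proof -
  let ?X = "gdom d" and ?Y = "gdom e" and ?Z = "gdom k" and ?X' = "gcod d" and ?Y' = "gcod e" and ?Z' = "gcod k"
  let ?p = "phi (?X @ ?Y) ?Z \<cdot> (phi ?X ?Y \<otimes> Id H (osem1 ?Z))"
  note [simp] = assms S_Dom S_Cod and [simp del] = sem.simps
  show ?thesis
  proof (rule iso_cancel_right[where p = ?p])
    have "tsem (TPar (TPar d e) k) \<cdot> ?p = (tsem (TPar (TPar d e) k) \<cdot> phi (gdom (TPar d e)) ?Z) \<cdot> (phi ?X ?Y \<otimes> Id H (osem1 ?Z))"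
      by simp
    also have "\<dots> = phi (?X' @ ?Y') ?Z' \<cdot> ((tsem (TPar d e) \<cdot> phi ?X ?Y) \<otimes> tsem k)"
      by (subst S_par_phi) simp_all
    also have "\<dots> = phi (?X' @ ?Y') ?Z' \<cdot> (phi ?X' ?Y' \<otimes> Id H (osem1 ?Z')) \<cdot> ((tsem d \<otimes> tsem e) \<otimes> tsem k)"
      by (subst S_par_phi) simp_all
    also have "\<dots> = (phi (?X' @ ?Y') ?Z' \<cdot> (phi ?X' ?Y' \<otimes> Id H (osem1 ?Z'))) \<cdot> ((tsem d \<otimes> tsem e) \<otimes> tsem k)"
      by simp
    also have "\<dots> = (phi ?X' (?Y' @ ?Z') \<cdot> (Id H (osem1 ?X') \<otimes> phi ?Y' ?Z') \<cdot> Assoc H (osem1 ?X') (osem1 ?Y') (osem1 ?Z')) \<cdot> ((tsem d \<otimes> tsem e) \<otimes> tsem k)"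
      by (simp only: phi_assoc)
    also have "\<dots> = phi ?X' (?Y' @ ?Z') \<cdot> (tsem d \<otimes> (phi ?Y' ?Z' \<cdot> (tsem e \<otimes> tsem k))) \<cdot> Assoc H (osem1 ?X) (osem1 ?Y) (osem1 ?Z)"
      by simp
    also have "\<dots> = phi ?X' (?Y' @ ?Z') \<cdot> (tsem d \<otimes> (tsem (TPar e k) \<cdot> phi ?Y ?Z)) \<cdot> Assoc H (osem1 ?X) (osem1 ?Y) (osem1 ?Z)"
      by (subst S_par_phi) simp_all
    also have "\<dots> = (phi (gcod d) (gcod (TPar e k)) \<cdot> (tsem d \<otimes> tsem (TPar e k))) \<cdot> (Id H (osem1 ?X) \<otimes> phi ?Y ?Z) \<cdot> Assoc H (osem1 ?X) (osem1 ?Y) (osem1 ?Z)"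
      by simp
    also have "\<dots> = (tsem (TPar d (TPar e k)) \<cdot> phi (gdom d) (gdom (TPar e k))) \<cdot> (Id H (osem1 ?X) \<otimes> phi ?Y ?Z) \<cdot> Assoc H (osem1 ?X) (osem1 ?Y) (osem1 ?Z)"
      by (subst S_par_phi) simp_all
    also have "\<dots> = tsem (TPar d (TPar e k)) \<cdot> (phi ?X (?Y @ ?Z) \<cdot> (Id H (osem1 ?X) \<otimes> phi ?Y ?Z) \<cdot> Assoc H (osem1 ?X) (osem1 ?Y) (osem1 ?Z))"
      by simp
    also have "\<dots> = tsem (TPar d (TPar e k)) \<cdot> ?p"
      by (simp only: phi_assoc)
    finally show "tsem (TPar (TPar d e) k) \<cdot> ?p = tsem (TPar d (TPar e k)) \<cdot> ?p" .
  qed simp_all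
qed

lemma S_par_right:
  assumes "gwf d"
  shows "tsem (TPar d (TId [])) = tsem d"
proof (rule iso_cancel_right[where p = "phi (gdom d) []"])
  note [simp] = assms S_Dom S_Cod and [simp del] = sem.simps
  have "tsem (TPar d (TId [])) \<cdot> phi (gdom d) [] = phi (gcod d) [] \<cdot> (tsem d \<otimes> Id H (osem1 []))"
    using S_par_phi[of d "TId []"] by (simp add: S_id)
  also have "\<dots> = tsem d \<cdot> phi (gdom d) []"
    using RUnit_pull[of "lunit_plus H (One H)" "tsem d" _ "Id H (osem1 (gdom d))"]
    by (simp add: phi_Nil_right osem1_Nil)
  finally show "tsem (TPar d (TId [])) \<cdot> phi (gdom d) [] = tsem d \<cdot> phi (gdom d) []" .
qed (use assms in \<open>simp_all add: S_Dom S_Cod del: sem.simps\<close>)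

lemma S_par_left:
  assumes "gwf d"
  shows "tsem (TPar (TId []) d) = tsem d"
proof (rule iso_cancel_right[where p = "phi [] (gdom d)"])
  note [simp] = assms S_Dom S_Cod and [simp del] = sem.simps
  have "tsem (TPar (TId []) d) \<cdot> phi [] (gdom d) = phi [] (gcod d) \<cdot> (Id H (osem1 []) \<otimes> tsem d)"
    using S_par_phi[of "TId []" d] by (simp add: S_id)
  also have "\<dots> = tsem d \<cdot> phi [] (gdom d)"
    using LUnit_pull[of "lunit_plus H (One H)" "tsem d" _ "Id H (osem1 (gdom d))"]
    by (simp add: phi_Nil_left osem1_Nil)
  finally show "tsem (TPar (TId []) d) \<cdot> phi [] (gdom d) = tsem d \<cdot> phi [] (gdom d)" .
qed (use assms in \<open>simp_all add: S_Dom S_Cod del: sem.simps\<close>)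

lemma Sym_Sym_Comp: "Cod H h = A \<otimes>\<^sub>o B \<Longrightarrow> Sym H B A \<cdot> Sym H A B \<cdot> h = h"
  by (simp add: Sym_Sym flip: Comp_assoc)

lemma S_swap_append:
  "tsem (TSwap X (Y @ Z)) = tsem (TSeq (TPar (TId Y) (TSwap X Z)) (TPar (TSwap X Y) (TId Z)))"
proof -
  let ?X = "osem1 X" and ?Y = "osem1 Y" and ?Z = "osem1 Z"
  let ?p = "phi X (Y @ Z) \<cdot> (Id H ?X \<otimes> phi Y Z) \<cdot> Assoc H ?X ?Y ?Z"
  let ?f = "TPar (TId Y) (TSwap X Z)" and ?g = "TPar (TSwap X Y) (TId Z)"
  note [simp] = S_Dom S_Cod and [simp del] = sem.simps
  have Sym_phi: "tsem (TSwap A B) \<cdot> phi A B = phi B A \<cdot> Sym H (osem1 A) (osem1 B)" for A B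
    by (simp add: S_swap)
  have f: "tsem ?f \<cdot> phi Y (X @ Z) = phi Y (Z @ X) \<cdot> (Id H ?Y \<otimes> tsem (TSwap X Z))"
    using S_par_phi[of "TId Y" "TSwap X Z"] by (simp add: S_id)
  have g: "tsem ?g \<cdot> phi (X @ Y) Z = phi (Y @ X) Z \<cdot> (tsem (TSwap X Y) \<otimes> Id H ?Z)"
    using S_par_phi[of "TSwap X Y" "TId Z"] by (simp add: S_id)
  show ?thesis
  proof (rule iso_cancel_right[where p = ?p])
    have "tsem (TSeq ?f ?g) \<cdot> ?p = tsem ?f \<cdot> tsem ?g \<cdot> (phi (X @ Y) Z \<cdot> (phi X Y \<otimes> Id H ?Z))"
      unfolding phi_assoc by (simp add: sem.simps(4))
    also have "\<dots> = tsem ?f \<cdot> (tsem ?g \<cdot> phi (X @ Y) Z) \<cdot> (phi X Y \<otimes> Id H ?Z)"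
      by simp
    also have "\<dots> = tsem ?f \<cdot> phi (Y @ X) Z \<cdot> ((tsem (TSwap X Y) \<cdot> phi X Y) \<otimes> Id H ?Z)"
      unfolding g by simp
    also have "\<dots> = tsem ?f \<cdot> (phi (Y @ X) Z \<cdot> (phi Y X \<otimes> Id H ?Z)) \<cdot> (Sym H ?X ?Y \<otimes> Id H ?Z)"
      unfolding Sym_phi by simp
    also have "\<dots> = (tsem ?f \<cdot> phi Y (X @ Z)) \<cdot> (Id H ?Y \<otimes> phi X Z) \<cdot> Assoc H ?Y ?X ?Z \<cdot> (Sym H ?X ?Y \<otimes> Id H ?Z)"
      unfolding phi_assoc[symmetric] by simp
    also have "\<dots> = phi Y (Z @ X) \<cdot> (Id H ?Y \<otimes> (tsem (TSwap X Z) \<cdot> phi X Z)) \<cdot> Assoc H ?Y ?X ?Z \<cdot> (Sym H ?X ?Y \<otimes> Id H ?Z)"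
      unfolding f by simp
    also have "\<dots> = phi Y (Z @ X) \<cdot> (Id H ?Y \<otimes> phi Z X) \<cdot> (Id H ?Y \<otimes> Sym H ?X ?Z) \<cdot> Assoc H ?Y ?X ?Z \<cdot> (Sym H ?X ?Y \<otimes> Id H ?Z)"
      unfolding Sym_phi by simp
    also have "\<dots> = phi Y (Z @ X) \<cdot> (Id H ?Y \<otimes> phi Z X) \<cdot> Assoc H ?Y ?Z ?X \<cdot> Sym H ?X (?Y \<otimes>\<^sub>o ?Z) \<cdot> Assoc H ?X ?Y ?Z"
      by (simp only: hexagon)
    also have "\<dots> = (phi Y (Z @ X) \<cdot> (Id H ?Y \<otimes> phi Z X) \<cdot> Assoc H ?Y ?Z ?X) \<cdot> Sym H ?X (?Y \<otimes>\<^sub>o ?Z) \<cdot> Assoc H ?X ?Y ?Z"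
      by simp
    also have "\<dots> = phi (Y @ Z) X \<cdot> ((phi Y Z \<otimes> Id H ?X) \<cdot> Sym H ?X (?Y \<otimes>\<^sub>o ?Z)) \<cdot> Assoc H ?X ?Y ?Z"
      unfolding phi_assoc by simp
    also have "\<dots> = (phi (Y @ Z) X \<cdot> Sym H ?X (osem1 (Y @ Z))) \<cdot> (Id H ?X \<otimes> phi Y Z) \<cdot> Assoc H ?X ?Y ?Z"
      by (subst Tens_Sym) simp_all
    also have "\<dots> = tsem (TSwap X (Y @ Z)) \<cdot> ?p"
      unfolding Sym_phi[symmetric] by simp
    finally show "tsem (TSwap X (Y @ Z)) \<cdot> ?p = tsem (TSeq ?f ?g) \<cdot> ?p" ..
  qed (simp_all add: sem.simps(4))
qed

theorem peq_sem: "peq gen_dom gen_cod gen_ok d e \<Longrightarrow> tsem d = tsem e"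
proof (induction rule: peq.induct)
  case (peq_seq d d' e e')
  then show ?case by simp
next
  case (peq_par d d' e e')
  then show ?case using peq_typing[OF peq_par(1)] peq_typing[OF peq_par(2)] by (simp add: S_par del: sem.simps(5))
next
  case (peq_seq_assoc k e d)
  then show ?case by (simp add: S_Dom S_Cod)
next
  case (peq_id_right d)
  then show ?case using S_id[of "gdom d"] by (simp add: S_Dom del: sem.simps(2))
next
  case (peq_id_left d)
  then show ?case using S_id[of "gcod d"] by (simp add: S_Cod del: sem.simps(2))
next
  case (peq_par_assoc d e k)
  then show ?case using S_par_assoc by simp
next
  case (peq_par_right d)
  then show ?case by (rule S_par_right)
next
  case (peq_par_left d)
  then show ?case by (rule S_par_left)
next
  case (peq_par_id X Y)
  then show ?case using S_par[of "TId X" "TId Y"] by (simp add: S_id del: sem.simps)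
next
  case (peq_interchange e d e' d')
  then have *: "gwf e" "gwf d" "gwf e'" "gwf d'" "gcod d = gdom e" "gcod d' = gdom e'" by auto
  then show ?case
    by (simp add: S_par S_Dom S_Cod del: sem.simps(1-3,5))
next
  case (peq_swap_natural d e)
  then show ?case
    by (simp add: S_par S_swap S_Dom S_Cod Sym_nat_Comp del: sem.simps(1-3,5))
next
  case (peq_swap_swap Y X)
  then show ?case
    by (simp add: S_swap S_id Sym_Sym_Comp del: sem.simps(1-3,5))
next
  case (peq_swap_append X Y Z)
  then show ?case by (rule S_swap_append)
qed auto

lemma TP_sem_class:
  assumes "K \<in> TP X Y" "d \<in> K"
  shows "TP_sem H scal K = tsem d"
proof -
  obtain d0 where K: "K = {e. peq gen_dom gen_cod gen_ok d0 e}"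
    using assms(1) by (auto simp: TP_def prop_hom_def quotient_def)
  have "tsem e = tsem d" if "e \<in> K" for e
    using peq_sem[of d0 e] peq_sem[of d0 d] that assms(2) unfolding K by simp
  then have "\<And>f. \<exists>e\<in>K. f = tsem e \<Longrightarrow> f = tsem d" by auto
  then show ?thesis
    unfolding TP_sem_def using assms(2) by (intro the_equality) blast+
qed

lemma TP_I:
  assumes "gwf d" "gdom d = X" "gcod d = Y"
  shows "\<exists>K\<in>TP X Y. d \<in> K \<and> TP_sem H scal K = tsem d"
proof -
  let ?K = "{e. peq gen_dom gen_cod gen_ok d e}"
  have "d \<in> ?K" using assms by (simp add: peq_refl)
  moreover have "?K \<in> TP X Y"
  proof -
    have "?K = {(d, e). peq gen_dom gen_cod gen_ok d e} `` {d}" by auto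
    moreover have "d \<in> terms gen_dom gen_cod gen_ok X Y" using assms by (simp add: terms_def)
    ultimately show ?thesis unfolding TP_def prop_hom_def by (metis quotientI)
  qed
  ultimately show ?thesis using TP_sem_class by blast
qed

end

end

theory Submission
  imports Defs
begin

text \<open>
  Every arrow between interpretations of single colours is the denotation of a functional diagram:
  the identity of such an object is a finite sum of arrows factoring through \<open>1\<close>, so that each arrow
  is a sum of arrows \<open>u \<cdot> s \<cdot> v\<close> with \<open>s\<close> a scalar.  A list \<open>X = [A\<^sub>1, \<dots>, A\<^sub>n]\<close> is encoded in the single
  colour \<open>C = (A\<^sub>1 \<oplus> 1) \<otimes> \<dots> \<otimes> (A\<^sub>n \<oplus> 1)\<close> (up to units), which denotes \<open>[[X]] \<oplus> 1\<close> up to an isomorphism \<open>\<theta>\<^sub>X\<close>.  Full diagrams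
  \<open>X \<rightarrow> C\<close> and \<open>C \<rightarrow> X\<close> denote the pairing \<open>(\<theta>\<^sub>X, \<pi>\<^sub>r)\<close> and the copairing \<open>(\<theta>\<^sub>X\<close>-inverse, \<open>\<iota>\<^sub>r)\<close>.  Composing
  them around the functional diagram for \<open>\<theta>\<^sub>Y \<cdot> g \<cdot>\<close> \<open>\<theta>\<^sub>X\<close>-inverse yields \<open>g + \<iota>\<^sub>r \<cdot> \<pi>\<^sub>r\<close>.
\<close>

section \<open>Sums of arrows\<close>

context semiadditive_category
begin

declare PrL_InL [simp] PrR_InR [simp] PrR_InL [simp] PrL_InR [simp]

lemma projection_injection_Comp [simp]:
  "Cod H f = A \<Longrightarrow> PrL H A B \<cdot> InL H A B \<cdot> f = f"
  "Cod H f = B \<Longrightarrow> PrR H A B \<cdot> InR H A B \<cdot> f = f"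
  "Cod H f = A \<Longrightarrow> PrR H A B \<cdot> InL H A B \<cdot> f = zero_arr H (Dom H f) B"
  "Cod H f = B \<Longrightarrow> PrL H A B \<cdot> InR H A B \<cdot> f = zero_arr H (Dom H f) A"
  by (simp_all flip: Comp_assoc)

lemma pair_zero_right: "Dom H f = A \<Longrightarrow> pair H f (zero_arr H A B) = InL H (Cod H f) B \<cdot> f"
  by (rule product_ext[where A = "Cod H f" and B = B]) simp_all

lemma pair_zero_left: "Dom H f = A \<Longrightarrow> pair H (zero_arr H A B) f = InR H B (Cod H f) \<cdot> f"
  by (rule product_ext[where A = B and B = "Cod H f"]) simp_all

lemma coproduct_ext:
  assumes "Dom H h = A \<oplus>\<^sub>o B" "Dom H h' = A \<oplus>\<^sub>o B" "Cod H h = Cod H h'"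
    and "h \<cdot> InL H A B = h' \<cdot> InL H A B" "h \<cdot> InR H A B = h' \<cdot> InR H A B"
  shows "h = h'"
  using coproduct[of "h \<cdot> InL H A B" A "Cod H h" "h \<cdot> InR H A B" B] assms by (auto simp: hom_def)

lemma codiag_In [simp]: "codiag H A \<cdot> InL H A A = Id H A" "codiag H A \<cdot> InR H A A = Id H A"
  using copair_facts[of "Id H A" "Id H A"] by (auto simp: codiag_def)

lemma codiag_In_Comp [simp]:
  "Cod H f = A \<Longrightarrow> codiag H A \<cdot> InL H A A \<cdot> f = f" "Cod H f = A \<Longrightarrow> codiag H A \<cdot> InR H A A \<cdot> f = f"
  by (simp_all flip: Comp_assoc)

lemma plus_InL: "Dom H f = A \<Longrightarrow> Dom H g = B \<Longrightarrow> (f \<oplus> g) \<cdot> InL H A B = InL H (Cod H f) (Cod H g) \<cdot> f"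
  by (rule product_ext[where A = "Cod H f" and B = "Cod H g"]) (simp_all add: plus_arr_def)

lemma plus_InR: "Dom H f = A \<Longrightarrow> Dom H g = B \<Longrightarrow> (f \<oplus> g) \<cdot> InR H A B = InR H (Cod H f) (Cod H g) \<cdot> g"
  by (rule product_ext[where A = "Cod H f" and B = "Cod H g"]) (simp_all add: plus_arr_def)

text \<open>Naturality of the codiagonal, seen on the two injections. Precomposition respects sums
  because pairing does; postcomposition needs this equation (see \<open>Comp_add\<close>).\<close>

lemma Comp_codiag: "h \<cdot> codiag H (Dom H h) = codiag H (Cod H h) \<cdot> (h \<oplus> h)"
  by (rule coproduct_ext[where A = "Dom H h" and B = "Dom H h"]) (simp_all add: plus_InL plus_InR)

lemma add_arr_eq:
  assumes "Dom H f = Dom H g" "Cod H f = Cod H g"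
  shows "f \<^bold>+ g = codiag H (Cod H f) \<cdot> pair H f g"
  using assms by (simp add: add_arr_def diag_def)

lemma add_typing [simp]:
  assumes "Dom H f = Dom H g" "Cod H f = Cod H g"
  shows "Dom H (f \<^bold>+ g) = Dom H f" "Cod H (f \<^bold>+ g) = Cod H f"
  using assms by (simp_all add: add_arr_eq)

lemma add_Comp:
  assumes "Dom H f = Dom H g" "Cod H f = Cod H g" "Cod H h = Dom H f"
  shows "(f \<^bold>+ g) \<cdot> h = (f \<cdot> h) \<^bold>+ (g \<cdot> h)"
  using assms by (simp add: add_arr_eq)

lemma Comp_add:
  assumes "Dom H f = Dom H g" "Cod H f = Cod H g" "Cod H f = Dom H h"
  shows "h \<cdot> (f \<^bold>+ g) = (h \<cdot> f) \<^bold>+ (h \<cdot> g)"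
proof -
  have "h \<cdot> (f \<^bold>+ g) = (h \<cdot> codiag H (Dom H h)) \<cdot> pair H f g"
    using assms by (simp add: add_arr_eq)
  also have "\<dots> = (h \<cdot> f) \<^bold>+ (h \<cdot> g)"
    unfolding Comp_codiag using assms by (simp add: add_arr_eq)
  finally show ?thesis .
qed

lemma add_zero: "f \<^bold>+ zero_arr H (Dom H f) (Cod H f) = f"
  by (simp add: add_arr_eq pair_zero_right)

lemma zero_add: "zero_arr H (Dom H f) (Cod H f) \<^bold>+ f = f"
  by (simp add: add_arr_eq pair_zero_left)

text \<open>Each projection annihilates one of the summands, so on components only the neutral laws
  for zero remain.\<close>

lemma Id_plus_eq: "Id H (A \<oplus>\<^sub>o B) = (InL H A B \<cdot> PrL H A B) \<^bold>+ (InR H A B \<cdot> PrR H A B)"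
  by (rule product_ext[where A = A and B = B])
     (simp_all add: Comp_add add_zero[of "PrL H A B", simplified] zero_add[of "PrR H A B", simplified])

lemma pair_eq_add:
  assumes "Dom H f = Dom H g" "Cod H f = A" "Cod H g = B"
  shows "pair H f g = (InL H A B \<cdot> f) \<^bold>+ (InR H A B \<cdot> g)"
proof -
  have "pair H f g = Id H (A \<oplus>\<^sub>o B) \<cdot> pair H f g" using assms by simp
  also have "\<dots> = (InL H A B \<cdot> f) \<^bold>+ (InR H A B \<cdot> g)"
    unfolding Id_plus_eq using assms by (simp add: add_Comp)
  finally show ?thesis .
qed

end

section \<open>Bilinearity of the tensor product\<close>

context distributive_category
begin

text \<open>The arrow factors through \<open>Dom H f\<close> \<otimes> 0, which
  \<open>annihilate_iso\<close> makes a zero object.\<close>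

lemma Tens_zero_right: "f \<otimes> zero_arr H A B = zero_arr H (Dom H f \<otimes>\<^sub>o A) (Cod H f \<otimes>\<^sub>o B)"
proof -
  let ?Z = "Dom H f \<otimes>\<^sub>o Zero H" and ?g = "f \<otimes> from_zero H B"
  have "?g = (?g \<cdot> inv_arr H (to_zero H ?Z)) \<cdot> to_zero H ?Z"
    using annihilate_iso[of "Dom H f"] by simp
  also have "?g \<cdot> inv_arr H (to_zero H ?Z) = from_zero H (Cod H f \<otimes>\<^sub>o B)"
    using annihilate_iso[of "Dom H f"] by (intro from_zero_unique) simp_all
  finally have "?g = zero_arr H ?Z (Cod H f \<otimes>\<^sub>o B)"
    by (simp add: zero_arr_def)
  moreover have "f \<otimes> zero_arr H A B = ?g \<cdot> (Id H (Dom H f) \<otimes> to_zero H A)"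
    by (simp add: zero_arr_def)
  ultimately show ?thesis by simp
qed

lemma Tens_zero_left: "zero_arr H A B \<otimes> f = zero_arr H (A \<otimes>\<^sub>o Dom H f) (B \<otimes>\<^sub>o Cod H f)"
proof -
  have "zero_arr H A B \<otimes> f = Sym H (Cod H f) B \<cdot> (f \<otimes> zero_arr H A B) \<cdot> Sym H A (Dom H f)"
    by (simp add: Sym_nat_Comp Sym_Sym)
  then show ?thesis by (simp add: Tens_zero_right)
qed

declare Tens_zero_right [simp] Tens_zero_left [simp]

text \<open>The inverse of \<open>distr\<close> carries the two injections to the injections
  tensored with \<open>Id H C\<close>, and on each of those the tensored codiagonal is the identity.
  Additivity of \<otimes> in its first argument is this equation applied to a pairing.\<close>

lemma codiag_distr: "codiag H (A \<otimes>\<^sub>o C) \<cdot> distr H A A C = codiag H A \<otimes> Id H C"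
proof -
  have l0: "distr H A A C \<cdot> (InL H A A \<otimes> Id H C) = InL H (A \<otimes>\<^sub>o C) (A \<otimes>\<^sub>o C)"
    using pair_zero_right[of "Id H (A \<otimes>\<^sub>o C)"] by (simp add: distr_def)
  have l: "inv_arr H (distr H A A C) \<cdot> InL H (A \<otimes>\<^sub>o C) (A \<otimes>\<^sub>o C) = InL H A A \<otimes> Id H C"
    by (simp flip: l0)
  have r0: "distr H A A C \<cdot> (InR H A A \<otimes> Id H C) = InR H (A \<otimes>\<^sub>o C) (A \<otimes>\<^sub>o C)"
    using pair_zero_left[of "Id H (A \<otimes>\<^sub>o C)"] by (simp add: distr_def)
  have r: "inv_arr H (distr H A A C) \<cdot> InR H (A \<otimes>\<^sub>o C) (A \<otimes>\<^sub>o C) = InR H A A \<otimes> Id H C"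
    by (simp flip: r0)
  have "codiag H (A \<otimes>\<^sub>o C) = (codiag H A \<otimes> Id H C) \<cdot> inv_arr H (distr H A A C)"
    by (rule coproduct_ext[where A = "A \<otimes>\<^sub>o C" and B = "A \<otimes>\<^sub>o C"]) (simp_all add: l r)
  then show ?thesis by simp
qed

lemma add_Tens:
  assumes "Dom H f = Dom H g" "Cod H f = Cod H g"
  shows "(f \<^bold>+ g) \<otimes> h = (f \<otimes> h) \<^bold>+ (g \<otimes> h)"
proof -
  have "(f \<^bold>+ g) \<otimes> h = (codiag H (Cod H f) \<otimes> Id H (Cod H h)) \<cdot> (pair H f g \<otimes> h)"
    using assms by (simp add: add_arr_eq)
  also have "\<dots> = codiag H (Cod H f \<otimes>\<^sub>o Cod H h) \<cdot> distr H (Cod H f) (Cod H f) (Cod H h) \<cdot> (pair H f g \<otimes> h)"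
    unfolding codiag_distr[symmetric] using assms by simp
  also have "\<dots> = (f \<otimes> h) \<^bold>+ (g \<otimes> h)"
    using assms by (simp add: add_arr_eq distr_def)
  finally show ?thesis .
qed

lemma Tens_add:
  assumes "Dom H f = Dom H g" "Cod H f = Cod H g"
  shows "h \<otimes> (f \<^bold>+ g) = (h \<otimes> f) \<^bold>+ (h \<otimes> g)"
proof -
  \<comment> \<open>Conjugation by the symmetry exchanges the arguments, so additivity in the second
    one follows from the first.\<close>
  have S: "h \<otimes> k = Sym H (Cod H k) (Cod H h) \<cdot> (k \<otimes> h) \<cdot> Sym H (Dom H h) (Dom H k)" for k
    by (simp add: Sym_nat_Comp Sym_Sym)
  show ?thesis
    unfolding S[of "f \<^bold>+ g"] S[of f] S[of g] add_Tens[OF assms]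
    using assms by (simp add: add_Comp Comp_add)
qed

end

section \<open>Functional diagrams between single wires\<close>

context tp_model
begin

abbreviation "fwf \<equiv> twf fgen_dom fgen_cod fgen_ok"
abbreviation "fdom \<equiv> tdom fgen_dom"
abbreviation "fcod \<equiv> tcod fgen_cod"

definition wire_hom :: "colour \<Rightarrow> colour \<Rightarrow> 'm set" where
  "wire_hom A B = {fsem H scal d | d. fwf d \<and> fdom d = [A] \<and> fcod d = [B]}"

lemma wire_homI: "fwf d \<Longrightarrow> fdom d = [A] \<Longrightarrow> fcod d = [B] \<Longrightarrow> fsem H scal d = f \<Longrightarrow> f \<in> wire_hom A B"
  unfolding wire_hom_def by blast

lemma wire_homE:
  assumes "f \<in> wire_hom A B"
  obtains d where "fwf d" "fdom d = [A]" "fcod d = [B]" "fsem H scal d = f"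
    "Dom H f = csem H A" "Cod H f = csem H B"
  using assms fsem_typing unfolding wire_hom_def by fastforce

lemma wire_hom_typing:
  assumes "f \<in> wire_hom A B"
  shows "Dom H f = csem H A" "Cod H f = csem H B"
  using assms by (auto elim: wire_homE)

section \<open>Closure of \<open>wire_hom\<close> under composition, tensor, sum and the biproduct
  structure\<close>

lemma wire_hom_Id: "Id H (csem H A) \<in> wire_hom A A"
  by (rule wire_homI[of "TId [A]"]) simp_all

lemma wire_hom_Comp: "f \<in> wire_hom A B \<Longrightarrow> g \<in> wire_hom B C \<Longrightarrow> g \<cdot> f \<in> wire_hom A C"
  by (elim wire_homE, rule wire_homI[of "TSeq _ _"]) auto

lemma wire_hom_zero: "zero_arr H (csem H A) (csem H B) \<in> wire_hom A B"
  by (rule wire_homI[of "TSeq (TGen (Null B)) (TGen (Null' A))"]) simp_all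

text \<open>\<open>Tensor'\<close> injects into the tensor summand of \<open>A | A'\<close>, where
  the parallel composition acts as \<open>f \<otimes> g\<close>, and \<open>Tensor\<close> projects
  back out. On two singletons \<open>merge\<close> is an identity.\<close>

lemma wire_hom_Tens:
  assumes "f \<in> wire_hom A B" "g \<in> wire_hom A' B'"
  shows "f \<otimes> g \<in> wire_hom (CTens A A') (CTens B B')"
proof -
  obtain d where d: "fwf d" "fdom d = [A]" "fcod d = [B]" "fsem H scal d = f" "Dom H f = csem H A" "Cod H f = csem H B"
    using assms(1) by (rule wire_homE)
  obtain e where e: "fwf e" "fdom e = [A']" "fcod e = [B']" "fsem H scal e = g" "Dom H g = csem H A'" "Cod H g = csem H B'"
    using assms(2) by (rule wire_homE)
  show ?thesis
    by (rule wire_homI[of "TSeq (TGen (Tensor B B')) (TSeq (TPar d e) (TGen (Tensor' A A')))"])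
       (simp_all add: d e merge_single BarO_def Bar_def PrL_plus_Comp)
qed

text \<open>The contractions do the same on the biproduct summand and supply the diagonal and
  codiagonal in the definition of \<open>add_arr\<close>.\<close>

lemma wire_hom_add:
  assumes "f \<in> wire_hom A B" "g \<in> wire_hom A B"
  shows "f \<^bold>+ g \<in> wire_hom A B"
proof -
  obtain d where d: "fwf d" "fdom d = [A]" "fcod d = [B]" "fsem H scal d = f" "Dom H f = csem H A" "Cod H f = csem H B"
    using assms(1) by (rule wire_homE)
  obtain e where e: "fwf e" "fdom e = [A]" "fcod e = [B]" "fsem H scal e = g" "Dom H g = csem H A" "Cod H g = csem H B"
    using assms(2) by (rule wire_homE)
  show ?thesis
    by (rule wire_homI[of "TSeq (TGen (Contraction B)) (TSeq (TPar d e) (TGen (Contraction' A)))"])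
       (simp_all add: d e merge_single BarO_def Bar_def PrR_plus_Comp add_arr_def)
qed

text \<open>\<open>Null'\<close> empties the second wire, and the right unitor in
  \<open>merge\<close> then projects onto the remaining summand.\<close>

lemma wire_hom_PrL: "PrL H (csem H A) (csem H B) \<in> wire_hom (CPlus A B) A"
  by (rule wire_homI[of "TSeq (TPar (TId [A]) (TGen (Null' B))) (TGen (Plus' A B))"])
     (simp_all add: merge_single merge_Nil runit_bar_def BarO_def Bar_def PrL_plus_Comp PrR_plus_Comp PrL_plus)

lemma wire_hom_PrR: "PrR H (csem H A) (csem H B) \<in> wire_hom (CPlus A B) B"
  by (rule wire_homI[of "TSeq (TPar (TGen (Null' A)) (TId [B])) (TGen (Plus' A B))"])
     (simp_all add: merge_single lunit_bar_def BarO_def Bar_def PrL_plus_Comp PrR_plus_Comp PrR_plus)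

lemma wire_hom_InL: "InL H (csem H A) (csem H B) \<in> wire_hom A (CPlus A B)"
proof (rule wire_homI[of "TSeq (TGen (Plus A B)) (TPar (TId [A]) (TGen (Null B)))"])
  let ?A = "csem H A" and ?B = "csem H B"
  \<comment> \<open>\<open>merge [A] []\<close> enters inverted here; stating the equation with the
    unitor itself on the right avoids computing that inverse.\<close>
  have *: "PrR H (?A \<otimes>\<^sub>o ?B) (?A \<oplus>\<^sub>o ?B) \<cdot> (Id H ?A \<star> zero_arr H (Zero H) ?B) = InL H ?A ?B \<cdot> runit_bar H ?A"
    by (rule product_ext[where A = ?A and B = ?B])
       (simp_all add: Bar_def BarO_def runit_bar_def PrL_plus_Comp PrR_plus PrR_plus_Comp)
  have "(PrR H (?A \<otimes>\<^sub>o ?B) (?A \<oplus>\<^sub>o ?B) \<cdot> (Id H ?A \<star> zero_arr H (Zero H) ?B)) \<cdot> inv_arr H (runit_bar H ?A) = InL H ?A ?B"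
    unfolding * by simp
  then show "fsem H scal (TSeq (TGen (Plus A B)) (TPar (TId [A]) (TGen (Null B)))) = InL H ?A ?B"
    by (simp add: merge_single merge_Nil BarO_def)
qed simp_all

lemma wire_hom_InR: "InR H (csem H A) (csem H B) \<in> wire_hom B (CPlus A B)"
proof (rule wire_homI[of "TSeq (TGen (Plus A B)) (TPar (TGen (Null A)) (TId [B]))"])
  let ?A = "csem H A" and ?B = "csem H B"
  have *: "PrR H (?A \<otimes>\<^sub>o ?B) (?A \<oplus>\<^sub>o ?B) \<cdot> (zero_arr H (Zero H) ?A \<star> Id H ?B) = InR H ?A ?B \<cdot> lunit_bar H ?B"
    by (rule product_ext[where A = ?A and B = ?B])
       (simp_all add: Bar_def BarO_def lunit_bar_def PrL_plus_Comp PrR_plus PrR_plus_Comp)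
  have "(PrR H (?A \<otimes>\<^sub>o ?B) (?A \<oplus>\<^sub>o ?B) \<cdot> (zero_arr H (Zero H) ?A \<star> Id H ?B)) \<cdot> inv_arr H (lunit_bar H ?B) = InR H ?A ?B"
    unfolding * by simp
  then show "fsem H scal (TSeq (TGen (Plus A B)) (TPar (TGen (Null A)) (TId [B]))) = InR H ?A ?B"
    by (simp add: merge_single BarO_def)
qed simp_all

lemma smult_Id_One: "smult H scal s (Id H (One H)) = scal s"
proof -
  have "(RUnit H (One H) \<cdot> (scal s \<otimes> Id H (One H))) \<cdot> inv_arr H (RUnit H (One H)) = scal s"
    by (subst RUnit_nat) simp_all
  then show ?thesis by (simp add: smult_def LUnit_One)
qed

text \<open>Surjectivity of \<open>scal\<close> enters here: the arrow is the value of some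
  \<open>Scalar\<close> generator.\<close>

lemma wire_hom_One:
  assumes "Dom H f = One H" "Cod H f = One H"
  shows "f \<in> wire_hom C1 C1"
proof -
  obtain s where "f = scal s"
    using scal_bij assms unfolding bij_betw_def hom_def by blast
  then show ?thesis
    by (intro wire_homI[of "TGen (Scalar s C1)"]) (simp_all add: smult_Id_One)
qed

text \<open>Adapters are only known up to the choice of a canonical isomorphism.  On \<open>1 \<otimes> 1\<close> any two
  choices differ by a scalar, so coherence is not needed.\<close>

lemma wire_hom_LUnit_One: "LUnit H (One H) \<in> wire_hom (CTens C1 C1) C1"
proof -
  let ?a = "adapter H (CTens C1 C1) C1"
  have *: "CTens C1 C1 \<approx> C1" by (rule ceq_tens_left)
  have "?a \<in> wire_hom (CTens C1 C1) C1"
    by (rule wire_homI[of "TGen (Adapter (CTens C1 C1) C1)"]) (simp_all add: *)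
  moreover have "LUnit H (One H) \<cdot> inv_arr H ?a \<in> wire_hom C1 C1"
    by (rule wire_hom_One) (simp_all add: *)
  ultimately have "(LUnit H (One H) \<cdot> inv_arr H ?a) \<cdot> ?a \<in> wire_hom (CTens C1 C1) C1"
    by (rule wire_hom_Comp)
  then show ?thesis by (simp add: *)
qed

lemma wire_hom_inv_LUnit_One: "inv_arr H (LUnit H (One H)) \<in> wire_hom C1 (CTens C1 C1)"
proof -
  let ?a = "adapter H C1 (CTens C1 C1)"
  have *: "C1 \<approx> CTens C1 C1" by (rule ceq_sym[OF ceq_tens_left])
  have "?a \<in> wire_hom C1 (CTens C1 C1)"
    by (rule wire_homI[of "TGen (Adapter C1 (CTens C1 C1))"]) (simp_all add: *)
  moreover have "inv_arr H ?a \<cdot> inv_arr H (LUnit H (One H)) \<in> wire_hom C1 C1"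
    by (rule wire_hom_One) (simp_all add: *)
  ultimately have "?a \<cdot> inv_arr H ?a \<cdot> inv_arr H (LUnit H (One H)) \<in> wire_hom C1 (CTens C1 C1)"
    using wire_hom_Comp by fastforce
  then show ?thesis by (simp add: *)
qed

section \<open>Finite-rank arrows and fullness on single wires\<close>

text \<open>Plays the role of a matrix expansion over the scalars. Taking both factors from
  \<open>wire_hom\<close> makes every such sum a denotation; the zero arrow is the empty
  sum.\<close>

inductive finite_rank :: "colour \<Rightarrow> colour \<Rightarrow> 'm \<Rightarrow> bool" for A B where
  finite_rank_zero: "finite_rank A B (zero_arr H (csem H A) (csem H B))"
| finite_rank_Comp: "v \<in> wire_hom A C1 \<Longrightarrow> u \<in> wire_hom C1 B \<Longrightarrow> finite_rank A B (u \<cdot> v)"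
| finite_rank_add: "finite_rank A B f \<Longrightarrow> finite_rank A B g \<Longrightarrow> finite_rank A B (f \<^bold>+ g)"

lemma finite_rank_typing: "finite_rank A B f \<Longrightarrow> Dom H f = csem H A \<and> Cod H f = csem H B"
  by (induction rule: finite_rank.induct) (auto simp: wire_hom_typing)

lemma finite_rank_wire_hom: "finite_rank A B f \<Longrightarrow> f \<in> wire_hom A B"
  by (induction rule: finite_rank.induct) (auto intro: wire_hom_zero wire_hom_Comp wire_hom_add)

lemma finite_rank_Comp_left:
  assumes "finite_rank A B f" "w \<in> wire_hom B B'"
  shows "finite_rank A B' (w \<cdot> f)"
  using assms(1)
proof induction
  case finite_rank_zero
  show ?case using finite_rank.finite_rank_zero assms(2) by (simp add: wire_hom_typing)
next
  case (finite_rank_Comp v u)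
  then show ?case
    using finite_rank.finite_rank_Comp[OF _ wire_hom_Comp[OF _ assms(2)]] assms(2) by (simp add: wire_hom_typing)
next
  case (finite_rank_add f g)
  then show ?case
    using finite_rank.finite_rank_add[of A B' "w \<cdot> f" "w \<cdot> g"] assms(2)
    by (simp add: Comp_add finite_rank_typing wire_hom_typing)
qed

lemma finite_rank_Comp_right:
  assumes "finite_rank A B f" "w \<in> wire_hom A' A"
  shows "finite_rank A' B (f \<cdot> w)"
  using assms(1)
proof induction
  case finite_rank_zero
  show ?case using finite_rank.finite_rank_zero assms(2) by (simp add: wire_hom_typing)
next
  case (finite_rank_Comp v u)
  then show ?case
    using finite_rank.finite_rank_Comp[OF wire_hom_Comp[OF assms(2)]] assms(2) by (simp add: wire_hom_typing)
next
  case (finite_rank_add f g)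
  then show ?case
    using finite_rank.finite_rank_add[of A' B "f \<cdot> w" "g \<cdot> w"] assms(2)
    by (simp add: add_Comp finite_rank_typing wire_hom_typing)
qed

lemma finite_rank_Tens_simple:
  assumes "v \<in> wire_hom A C1" "u \<in> wire_hom C1 B" "finite_rank A' B' g"
  shows "finite_rank (CTens A A') (CTens B B') ((u \<cdot> v) \<otimes> g)"
  using assms(3)
proof induction
  case finite_rank_zero
  show ?case
    using finite_rank.finite_rank_zero[of "CTens A A'" "CTens B B'"] assms(1,2) by (simp add: wire_hom_typing)
next
  case (finite_rank_Comp v' u')
  note assms(1,2) finite_rank_Comp
  note [simp] = this[THEN wire_hom_typing(1)] this[THEN wire_hom_typing(2)]
  \<comment> \<open>The tensor product of two arrows through 1 passes through 1 \<otimes> 1, which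
    \<open>LUnit H (One H)\<close> contracts to 1.\<close>
  have "LUnit H (One H) \<cdot> (v \<otimes> v') \<in> wire_hom (CTens A A') C1"
    using wire_hom_Comp[OF wire_hom_Tens[OF assms(1) finite_rank_Comp(1)] wire_hom_LUnit_One] .
  moreover have "(u \<otimes> u') \<cdot> inv_arr H (LUnit H (One H)) \<in> wire_hom C1 (CTens B B')"
    using wire_hom_Comp[OF wire_hom_inv_LUnit_One wire_hom_Tens[OF assms(2) finite_rank_Comp(2)]] .
  ultimately show ?case
    using finite_rank.finite_rank_Comp by force
next
  case (finite_rank_add f g)
  then show ?case
    using finite_rank.finite_rank_add[OF finite_rank_add.IH] by (simp add: Tens_add finite_rank_typing)
qed

lemma finite_rank_Tens:
  assumes "finite_rank A B f" "finite_rank A' B' g"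
  shows "finite_rank (CTens A A') (CTens B B') (f \<otimes> g)"
  using assms(1)
proof induction
  case finite_rank_zero
  show ?case
    using finite_rank.finite_rank_zero[of "CTens A A'" "CTens B B'"] assms(2) by (simp add: finite_rank_typing)
next
  case (finite_rank_Comp v u)
  then show ?case using finite_rank_Tens_simple assms(2) by blast
next
  case (finite_rank_add f g)
  then show ?case
    using finite_rank.finite_rank_add[OF finite_rank_add.IH] by (simp add: add_Tens finite_rank_typing)
qed

text \<open>Structural induction: 0 gives the empty sum, 1 a single term, a biproduct the terms of
  both summands via \<open>Id_plus_eq\<close>, and a tensor the products of terms by
  bilinearity.\<close>

lemma finite_rank_Id: "finite_rank A A (Id H (csem H A))"
proof (induction A)
  case C0
  have "Id H (Zero H) = zero_arr H (Zero H) (Zero H)" by (rule to_zero_unique) simp_all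
  then show ?case using finite_rank_zero[of C0 C0] by simp
next
  case C1
  then show ?case
    using finite_rank_Comp[OF wire_hom_Id wire_hom_Id] by simp
next
  case (CPlus A B)
  let ?A = "csem H A" and ?B = "csem H B"
  have "finite_rank (CPlus A B) (CPlus A B) (InL H ?A ?B \<cdot> (Id H ?A \<cdot> PrL H ?A ?B))"
    by (rule finite_rank_Comp_left[OF finite_rank_Comp_right[OF CPlus(1) wire_hom_PrL] wire_hom_InL])
  moreover have "finite_rank (CPlus A B) (CPlus A B) (InR H ?A ?B \<cdot> (Id H ?B \<cdot> PrR H ?A ?B))"
    by (rule finite_rank_Comp_left[OF finite_rank_Comp_right[OF CPlus(2) wire_hom_PrR] wire_hom_InR])
  ultimately show ?case
    using finite_rank_add by (simp add: Id_plus_eq)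
next
  case (CTens A B)
  then show ?case using finite_rank_Tens[OF CTens] by simp
qed

text \<open>The arrow \<open>f\<close> is arbitrary: once \<open>h\<close> and \<open>k\<close> are
  expanded, each nonzero term contains it only inside an endomorphism
  \<open>v' \<cdot> f \<cdot> u\<close> of 1, which is a scalar.\<close>

lemma finite_rank_sandwich:
  assumes "finite_rank A A h" "finite_rank B B k" "Dom H f = csem H A" "Cod H f = csem H B"
  shows "finite_rank A B (k \<cdot> f \<cdot> h)"
  using assms(2)
proof induction
  case finite_rank_zero
  show ?case
    using finite_rank.finite_rank_zero[of A B] assms by (simp add: finite_rank_typing)
next
  case (finite_rank_Comp v' u')
  note k = finite_rank_Comp
  show ?case
    using assms(1)
  proof induction
    case finite_rank_zero
    show ?case
      using finite_rank.finite_rank_zero[of A B] assms k by (simp add: wire_hom_typing)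
  next
    case (finite_rank_Comp v u)
    have "v' \<cdot> f \<cdot> u \<in> wire_hom C1 C1"
      by (rule wire_hom_One) (use assms k finite_rank_Comp in \<open>simp_all add: wire_hom_typing\<close>)
    then have "finite_rank A B (u' \<cdot> (v' \<cdot> f \<cdot> u) \<cdot> v)"
      by (intro finite_rank.finite_rank_Comp[of "_ \<cdot> _"] wire_hom_Comp[OF finite_rank_Comp(1)] k(2))
    then show ?case
      using assms k finite_rank_Comp by (simp add: wire_hom_typing)
  next
    case (finite_rank_add g h)
    then show ?case
      using finite_rank.finite_rank_add[OF finite_rank_add.IH] assms k
      by (simp add: Comp_add finite_rank_typing wire_hom_typing)
  qed
next
  case (finite_rank_add k l)
  then show ?case
    using finite_rank.finite_rank_add[OF finite_rank_add.IH] assms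
    by (simp add: add_Comp finite_rank_typing)
qed

text \<open>Sandwiching \<open>f\<close> between two identities, which have finite rank, writes
  \<open>f\<close> itself as such a sum.\<close>

theorem wire_hom_full: "Dom H f = csem H A \<Longrightarrow> Cod H f = csem H B \<Longrightarrow> f \<in> wire_hom A B"
  using finite_rank_wire_hom[OF finite_rank_sandwich[OF finite_rank_Id finite_rank_Id]] by fastforce

end

section \<open>Encoding lists of wires\<close>

context distributive_category
begin

text \<open>The four blocks of (A \<oplus> 1) \<otimes> (B \<oplus> 1). Parallel composition
  involves the inverse of \<open>expand\<close>; restricting to blocks lets the decoding diagrams be
  computed without it.\<close>

lemma expand_injections:
  "expand H A B \<cdot> (InL H A (One H) \<otimes> InL H B (One H)) = InL H (A \<star>\<^sub>o B) (One H) \<cdot> InL H (A \<otimes>\<^sub>o B) (A \<oplus>\<^sub>o B)"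
  "expand H A B \<cdot> (InL H A (One H) \<otimes> InR H B (One H)) =
     InL H (A \<star>\<^sub>o B) (One H) \<cdot> InR H (A \<otimes>\<^sub>o B) (A \<oplus>\<^sub>o B) \<cdot> InL H A B \<cdot> RUnit H A"
  "expand H A B \<cdot> (InR H A (One H) \<otimes> InL H B (One H)) =
     InL H (A \<star>\<^sub>o B) (One H) \<cdot> InR H (A \<otimes>\<^sub>o B) (A \<oplus>\<^sub>o B) \<cdot> InR H A B \<cdot> LUnit H B"
  "expand H A B \<cdot> (InR H A (One H) \<otimes> InR H B (One H)) = InR H (A \<star>\<^sub>o B) (One H) \<cdot> LUnit H (One H)"
  by (simp_all add: expand_eq BarO_def pair_zero_right pair_zero_left)

lemma Plus1_InR_Comp:
  "Dom H f = A \<Longrightarrow> Cod H k = One H \<Longrightarrow> Plus1 H f \<cdot> InR H A (One H) \<cdot> k = InR H (Cod H f) (One H) \<cdot> k"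
  by (simp add: Plus1_def plus_InR flip: Comp_assoc)

text \<open>On the adjoined unit \<open>phi\<close> is just the multiplication of 1, for projections
  here and for injections in \<open>phi_InR\<close>. This carries the second components through the
  induction in \<open>list_encode\<close>.\<close>

lemma PrR_phi: "PrR H (osem H (X @ Y)) (One H) \<cdot> phi X Y =
    LUnit H (One H) \<cdot> (PrR H (osem H X) (One H) \<otimes> PrR H (osem H Y) (One H))"
  by (simp add: phi_def Plus1_def PrR_plus_Comp BarO_def Plus1O_def) (simp add: expand_eq BarO_def)

lemma phi_InR: "phi X Y \<cdot> (InR H (osem H X) (One H) \<otimes> InR H (osem H Y) (One H)) =
    InR H (osem H (X @ Y)) (One H) \<cdot> LUnit H (One H)"
  by (simp add: phi_def expand_injections Plus1_InR_Comp Plus1O_def)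

end

context tp_model
begin

section \<open>Encoding and decoding of wires\<close>

text \<open>\<open>Unit\<close> duplicates the adjoined 1 onto a wire of colour \<open>C1\<close>.
  \<open>Plus\<close> collects that copy with \<open>B\<close>, so its output wire carries all of
  \<open>B \<oplus> 1\<close> while the original 1 stays adjoined.\<close>

lemma wire_encode:
  "\<exists>d. gwf d \<and> gdom d = [B] \<and> gcod d = [CPlus B C1]
     \<and> tsem d = pair H (Id H (osem1 [B])) (PrR H (csem H B) (One H))"
proof (intro exI conjI)
  let ?p = "TPar (TId [B]) (TGen Unit)" and ?d = "TSeq (TGen (Fun (Plus B C1))) (TPar (TId [B]) (TGen Unit))"
  show "tsem ?d = pair H (Id H (osem1 [B])) (PrR H (csem H B) (One H))"
  \<comment> \<open>Cancelling \<open>phi\<close> removes its inverse from the semantics of the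
    parallel composition and leaves the equation of \<open>S_par_phi\<close>.\<close>
  proof (rule iso_cancel_right[where p = "phi [B] []"])
    have "tsem ?p \<cdot> phi [B] [] = expand H (csem H B) (One H) \<cdot> (Id H (osem1 [B]) \<otimes> (diag H (One H) \<cdot> lunit_plus H (One H)))"
      using S_par_phi[of "TId [B]" "TGen Unit"] by (simp add: S_id phi_single psi_def del: sem.simps(2-5))
    then have "tsem ?d \<cdot> phi [B] [] = Plus1 H (PrR H (csem H B \<otimes>\<^sub>o One H) (csem H B \<oplus>\<^sub>o One H)) \<cdot>
        expand H (csem H B) (One H) \<cdot> (Id H (osem1 [B]) \<otimes> (diag H (One H) \<cdot> lunit_plus H (One H)))"
      using S_Dom[of ?p] S_Cod[of ?p] by (simp add: BarO_def Plus1O_def osem1_def del: sem.simps(5))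
    also have "\<dots> = pair H (Id H (osem1 [B])) (PrR H (csem H B) (One H)) \<cdot> phi [B] []"
      using RUnit_pair[of "lunit_plus H (One H)" "PrL H (csem H B) (One H)" "PrR H (csem H B) (One H)"]
      by (simp add: phi_Nil_right expand_eq Plus1_def osem1_def Plus1O_def diag_def LUnit_One BarO_def)
    finally show "tsem ?d \<cdot> phi [B] [] = pair H (Id H (osem1 [B])) (PrR H (csem H B) (One H)) \<cdot> phi [B] []" .
  qed (simp_all add: S_Dom S_Cod osem1_def Plus1O_def BarO_def)
qed simp_all

text \<open>Mirror image of \<open>wire_encode\<close>. The copairing is described by its two
  restrictions, the form in which the induction on lists uses it.\<close>

lemma wire_decode:
  "\<exists>e. gwf e \<and> gdom e = [CPlus B C1] \<and> gcod e = [B]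
     \<and> tsem e \<cdot> InL H (csem H (CPlus B C1)) (One H) = Id H (osem1 [B])
     \<and> tsem e \<cdot> InR H (csem H (CPlus B C1)) (One H) = InR H (csem H B) (One H)"
proof (intro exI conjI)
  let ?B = "csem H B" and ?o = "One H"
  let ?p = "TPar (TId [B]) (TGen Unit')"
  let ?e = "TSeq ?p (TGen (Fun (Plus' B C1)))"
  have [simp]: "Dom H (tsem ?p) = Plus1O H (?B \<star>\<^sub>o ?o)" "Cod H (tsem ?p) = osem1 [B]"
    using S_Dom[of ?p] S_Cod[of ?p] by (simp_all add: osem1_def del: sem.simps(5))
  have "tsem ?p \<cdot> expand H ?B ?o = phi [B] [] \<cdot> (Id H (osem1 [B]) \<otimes> (inv_arr H (lunit_plus H ?o) \<cdot> codiag H ?o))"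
    using S_par_phi[of "TId [B]" "TGen Unit'"] by (simp add: S_id phi_single psi_def del: sem.simps(2-5))
  also have "\<dots> = RUnit H (osem1 [B]) \<cdot> (Id H (osem1 [B]) \<otimes> codiag H ?o)"
    by (simp add: phi_Nil_right)
  finally have p: "tsem ?p \<cdot> expand H ?B ?o \<cdot> k = RUnit H (?B \<oplus>\<^sub>o ?o) \<cdot> (Id H (?B \<oplus>\<^sub>o ?o) \<otimes> codiag H ?o) \<cdot> k"
    if "Cod H k = (?B \<oplus>\<^sub>o ?o) \<otimes>\<^sub>o (?o \<oplus>\<^sub>o ?o)" for k
    using that by (simp add: osem1_def Plus1O_def BarO_def del: sem.simps(5) flip: Comp_assoc)
  let ?L = "InL H (?B \<star>\<^sub>o ?o) ?o" and ?R = "InR H (?B \<otimes>\<^sub>o ?o) (?B \<oplus>\<^sub>o ?o)"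
  \<comment> \<open>\<open>Plus'\<close> reaches only the biproduct summand, so the block of
    \<open>InL \<otimes> InL\<close> never occurs. The other three blocks give \<open>LL\<close>,
    \<open>LR\<close> and \<open>R\<close>; on each the codiagonal cancels the second
    injection.\<close>
  have LL: "(tsem ?p \<cdot> ?L \<cdot> ?R) \<cdot> InL H ?B ?o = InL H ?B ?o"
  proof (rule iso_cancel_right[where p = "RUnit H ?B"])
    show "((tsem ?p \<cdot> ?L \<cdot> ?R) \<cdot> InL H ?B ?o) \<cdot> RUnit H ?B = InL H ?B ?o \<cdot> RUnit H ?B"
      using p[of "InL H ?B ?o \<otimes> InR H ?o ?o"] RUnit_nat[of "InL H ?B ?o"]
      by (simp add: expand_injections BarO_def Plus1O_def del: sem.simps)
  qed (simp_all add: BarO_def Plus1O_def osem1_def del: sem.simps)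
  have LR: "(tsem ?p \<cdot> ?L \<cdot> ?R) \<cdot> InR H ?B ?o = InR H ?B ?o"
  proof (rule iso_cancel_right[where p = "RUnit H ?o"])
    show "((tsem ?p \<cdot> ?L \<cdot> ?R) \<cdot> InR H ?B ?o) \<cdot> RUnit H ?o = InR H ?B ?o \<cdot> RUnit H ?o"
      using p[of "InR H ?B ?o \<otimes> InL H ?o ?o"] RUnit_nat[of "InR H ?B ?o"]
      by (simp add: expand_injections BarO_def Plus1O_def LUnit_One del: sem.simps)
  qed (simp_all add: BarO_def Plus1O_def osem1_def del: sem.simps)
  have R: "tsem ?p \<cdot> InR H (?B \<star>\<^sub>o ?o) ?o = InR H ?B ?o"
  proof (rule iso_cancel_right[where p = "RUnit H ?o"])
    show "(tsem ?p \<cdot> InR H (?B \<star>\<^sub>o ?o) ?o) \<cdot> RUnit H ?o = InR H ?B ?o \<cdot> RUnit H ?o"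
      using p[of "InR H ?B ?o \<otimes> InR H ?o ?o"] RUnit_nat[of "InR H ?B ?o"]
      by (simp add: expand_injections BarO_def Plus1O_def LUnit_One del: sem.simps)
  qed (simp_all add: BarO_def Plus1O_def osem1_def del: sem.simps)
  have e: "tsem ?e = tsem ?p \<cdot> Plus1 H ?R"
    by (simp del: sem.simps(5))
  have "tsem ?p \<cdot> ?L \<cdot> ?R = Id H (?B \<oplus>\<^sub>o ?o)"
    by (rule coproduct_ext[where A = ?B and B = ?o])
       (use LL LR in \<open>simp_all add: BarO_def Plus1O_def osem1_def del: sem.simps\<close>)
  then show "tsem ?e \<cdot> InL H (csem H (CPlus B C1)) ?o = Id H (osem1 [B])"
    using Plus1_InL[of ?R] unfolding e by (simp add: BarO_def Plus1O_def osem1_def del: sem.simps)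
  show "tsem ?e \<cdot> InR H (csem H (CPlus B C1)) ?o = InR H ?B ?o"
    using R unfolding e by (simp add: Plus1_def plus_InR BarO_def Plus1O_def osem1_def del: sem.simps)
qed simp_all

text \<open>The induction step puts the encoding of \<open>X\<close> in parallel with that of
  \<open>B\<close> and lets \<open>Tensor\<close> select the tensor component; decoding reverses
  this with \<open>Tensor'\<close>.\<close>

lemma list_encode:
  "\<exists>C \<theta> d e. is_iso H \<theta> \<and> Dom H \<theta> = osem1 X \<and> Cod H \<theta> = csem H C
     \<and> gwf d \<and> gdom d = X \<and> gcod d = [C] \<and> tsem d = pair H \<theta> (PrR H (osem H X) (One H))
     \<and> gwf e \<and> gdom e = [C] \<and> gcod e = X \<and> tsem e \<cdot> InL H (csem H C) (One H) = inv_arr H \<theta>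
     \<and> tsem e \<cdot> InR H (csem H C) (One H) = InR H (osem H X) (One H)"
proof (induction X rule: rev_induct)
  case Nil
  \<comment> \<open>The colour for the empty list is \<open>C1\<close>. The codiagonal in
    \<open>Unit'\<close> cancels either injection and leaves this inverse, which must therefore
    agree with \<open>InR\<close>.\<close>
  have "inv_arr H (lunit_plus H (One H)) = InR H (Zero H) (One H)"
    by (rule iso_cancel_left[where p = "lunit_plus H (One H)"]) (simp_all, simp add: lunit_plus_def)
  then show ?case
    by (intro exI[of _ C1] exI[of _ "lunit_plus H (One H)"] exI[of _ "TGen Unit"] exI[of _ "TGen Unit'"])
       (simp add: diag_def osem1_Nil, simp add: lunit_plus_def)
next
  case (snoc B X)
  then obtain C \<theta> d e where \<theta>: "is_iso H \<theta>" "Dom H \<theta> = osem1 X" "Cod H \<theta> = csem H C"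
    and d: "gwf d" "gdom d = X" "gcod d = [C]" "tsem d = pair H \<theta> (PrR H (osem H X) (One H))"
    and e: "gwf e" "gdom e = [C]" "gcod e = X" "tsem e \<cdot> InL H (csem H C) (One H) = inv_arr H \<theta>"
      "tsem e \<cdot> InR H (csem H C) (One H) = InR H (osem H X) (One H)"
    by blast
  let ?B = "CPlus B C1"
  obtain d\<^sub>B where d\<^sub>B: "gwf d\<^sub>B" "gdom d\<^sub>B = [B]" "gcod d\<^sub>B = [?B]"
      "tsem d\<^sub>B = pair H (Id H (osem1 [B])) (PrR H (csem H B) (One H))"
    using wire_encode[of B] by blast
  obtain e\<^sub>B where e\<^sub>B: "gwf e\<^sub>B" "gdom e\<^sub>B = [?B]" "gcod e\<^sub>B = [B]"
      "tsem e\<^sub>B \<cdot> InL H (csem H ?B) (One H) = Id H (osem1 [B])"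
      "tsem e\<^sub>B \<cdot> InR H (csem H ?B) (One H) = InR H (csem H B) (One H)"
    using wire_decode[of B] by blast
  \<comment> \<open>\<open>phi X [B]\<close> identifies \<open>osem1 X \<otimes> osem1 [B]\<close>
    with \<open>osem1 (X @ [B])\<close>. The second factor is an identity because
    \<open>osem1 [B]\<close> is the object of \<open>CPlus B C1\<close>.\<close>
  let ?\<theta> = "(\<theta> \<otimes> Id H (osem1 [B])) \<cdot> inv_arr H (phi X [B])"
  let ?pd = "TPar d d\<^sub>B" and ?pe = "TPar e e\<^sub>B"
  let ?d = "TSeq (TGen (Fun (Tensor C ?B))) ?pd" and ?e = "TSeq ?pe (TGen (Fun (Tensor' C ?B)))"
  let ?C = "csem H C" and ?CB = "csem H B \<oplus>\<^sub>o One H"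
  have \<theta>': "is_iso H ?\<theta>" "Dom H ?\<theta> = osem1 (X @ [B])" "Cod H ?\<theta> = csem H (CTens C ?B)"
    using \<theta> by (simp_all add: osem1_def Plus1O_def)
  note [simp] = \<theta>
  have td: "tsem ?d = pair H ?\<theta> (PrR H (osem H (X @ [B])) (One H))"
  proof (rule iso_cancel_right[where p = "phi X [B]"])
    have "tsem ?pd \<cdot> phi X [B] = expand H ?C ?CB \<cdot> (tsem d \<otimes> tsem d\<^sub>B)"
      using S_par_phi[OF d(1) d\<^sub>B(1)] by (simp add: d d\<^sub>B phi_single[of "[_]"] psi_def del: sem.simps)
    then have "tsem ?d \<cdot> phi X [B] = Plus1 H (PrL H (?C \<otimes>\<^sub>o ?CB) (?C \<oplus>\<^sub>o ?CB)) \<cdot> expand H ?C ?CB \<cdot> (tsem d \<otimes> tsem d\<^sub>B)"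
      using S_Dom[of ?pd] S_Cod[of ?pd] by (simp add: d d\<^sub>B BarO_def Plus1O_def osem1_def del: sem.simps(5))
    \<comment> \<open>The tensor component of \<open>expand\<close> tensors the first components of
      the two encodings; its adjoined component multiplies their projections to 1, in agreement with
      \<open>PrR_phi\<close>.\<close>
    also have "\<dots> = pair H (\<theta> \<otimes> Id H (osem1 [B])) (LUnit H (One H) \<cdot> (PrR H (osem H X) (One H) \<otimes> PrR H (csem H B) (One H)))"
      by (simp add: d d\<^sub>B expand_eq Plus1_def osem1_def Plus1O_def BarO_def)
    also have "\<dots> = pair H ?\<theta> (PrR H (osem H (X @ [B])) (One H)) \<cdot> phi X [B]"
      using PrR_phi[of X "[B]"] by (simp add: osem1_def Plus1O_def)
    finally show "tsem ?d \<cdot> phi X [B] = pair H ?\<theta> (PrR H (osem H (X @ [B])) (One H)) \<cdot> phi X [B]" .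
  qed (use S_Dom[of ?d] S_Cod[of ?d] d d\<^sub>B \<theta>' in \<open>simp_all add: osem1_def Plus1O_def del: sem.simps\<close>)
  have pe: "tsem ?pe \<cdot> expand H ?C ?CB = phi X [B] \<cdot> (tsem e \<otimes> tsem e\<^sub>B)"
    using S_par_phi[OF e(1) e\<^sub>B(1)] by (simp add: e e\<^sub>B phi_single[of "[_]"] psi_def del: sem.simps)
  have [simp]: "Dom H (tsem ?pe) = Plus1O H (?C \<star>\<^sub>o ?CB)" "Cod H (tsem ?pe) = osem1 (X @ [B])"
    "Dom H (tsem e) = ?C \<oplus>\<^sub>o One H" "Dom H (tsem e\<^sub>B) = ?CB \<oplus>\<^sub>o One H"
    "Cod H (tsem e) = osem1 X" "Cod H (tsem e\<^sub>B) = osem1 [B]"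
    using S_Dom[of ?pe] S_Cod[of ?pe] S_Dom[of e] S_Dom[of e\<^sub>B] S_Cod[of e] S_Cod[of e\<^sub>B] e e\<^sub>B
    by (simp_all add: osem1_def Plus1O_def del: sem.simps(5))
  have te: "tsem ?e = tsem ?pe \<cdot> Plus1 H (InL H (?C \<otimes>\<^sub>o ?CB) (?C \<oplus>\<^sub>o ?CB))"
    by (simp del: sem.simps(5))
  \<comment> \<open>\<open>Tensor'\<close> selects the block of \<open>InL \<otimes> InL\<close>, on
    which the two decodings restrict to the inverse of \<theta> and to an identity.\<close>
  have "tsem ?e \<cdot> InL H (?C \<otimes>\<^sub>o ?CB) (One H) = (tsem ?pe \<cdot> expand H ?C ?CB) \<cdot> (InL H ?C (One H) \<otimes> InL H ?CB (One H))"
    using Plus1_InL[of "InL H (?C \<otimes>\<^sub>o ?CB) (?C \<oplus>\<^sub>o ?CB)"]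
    unfolding te by (simp add: expand_injections BarO_def Plus1O_def del: sem.simps)
  also have "\<dots> = inv_arr H ?\<theta>"
    using e e\<^sub>B unfolding pe by (simp add: osem1_def Plus1O_def inv_of_Comp inv_Tens del: sem.simps)
  finally have teL: "tsem ?e \<cdot> InL H (?C \<otimes>\<^sub>o ?CB) (One H) = inv_arr H ?\<theta>" .
  have teR: "tsem ?e \<cdot> InR H (?C \<otimes>\<^sub>o ?CB) (One H) = InR H (osem H (X @ [B])) (One H)"
  proof (rule iso_cancel_right[where p = "LUnit H (One H)"])
    have "(tsem ?e \<cdot> InR H (?C \<otimes>\<^sub>o ?CB) (One H)) \<cdot> LUnit H (One H)
        = (tsem ?pe \<cdot> expand H ?C ?CB) \<cdot> (InR H ?C (One H) \<otimes> InR H ?CB (One H))"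
      unfolding te by (simp add: expand_injections Plus1_InR_Comp BarO_def Plus1O_def del: sem.simps)
    also have "\<dots> = InR H (osem H (X @ [B])) (One H) \<cdot> LUnit H (One H)"
      using e e\<^sub>B phi_InR[of X "[B]"] unfolding pe by (simp add: osem1_def Plus1O_def del: sem.simps)
    finally show "(tsem ?e \<cdot> InR H (?C \<otimes>\<^sub>o ?CB) (One H)) \<cdot> LUnit H (One H)
        = InR H (osem H (X @ [B])) (One H) \<cdot> LUnit H (One H)" .
  qed (use S_Dom[of ?e] S_Cod[of ?e] e e\<^sub>B in \<open>simp_all add: osem1_def Plus1O_def del: sem.simps\<close>)
  show ?case
    by (intro exI[of _ "CTens C ?B"] exI[of _ ?\<theta>] exI[of _ ?d] exI[of _ ?e] conjI \<theta>' td)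
       (use d d\<^sub>B e e\<^sub>B teL teR in \<open>simp_all del: sem.simps\<close>)
qed

section \<open>Assembly of the full diagram\<close>

theorem TP_full:
  assumes "f \<in> hom1 H (osem H X) (osem H Y)"
  shows "\<exists>K \<in> TP X Y. TP_sem H scal K = f"
proof -
  obtain C \<theta> d e' where \<theta>: "is_iso H \<theta>" "Dom H \<theta> = osem1 X" "Cod H \<theta> = csem H C"
    and d: "gwf d" "gdom d = X" "gcod d = [C]" "tsem d = pair H \<theta> (PrR H (osem H X) (One H))"
    using list_encode[of X] by blast
  obtain D \<chi> d' e where \<chi>: "is_iso H \<chi>" "Dom H \<chi> = osem1 Y" "Cod H \<chi> = csem H D"
    and e: "gwf e" "gdom e = [D]" "gcod e = Y" "tsem e \<cdot> InL H (csem H D) (One H) = inv_arr H \<chi>"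
      "tsem e \<cdot> InR H (csem H D) (One H) = InR H (osem H Y) (One H)"
    using list_encode[of Y] by blast
  obtain g where g: "Dom H g = osem1 X" "Cod H g = osem1 Y"
    and f: "f = g \<^bold>+ (InR H (osem H Y) (One H) \<cdot> PrR H (osem H X) (One H))"
    using assms by (auto simp: hom1_def hom_def osem1_def)
  \<comment> \<open>Conjugation by the encodings turns \<open>g\<close> into an arrow between
    objects of single colours, the case settled by \<open>wire_hom_full\<close>.\<close>
  have "\<chi> \<cdot> g \<cdot> inv_arr H \<theta> \<in> wire_hom C D"
    using \<theta> \<chi> g by (intro wire_hom_full) simp_all
  then obtain m where m: "fwf m" "fdom m = [C]" "fcod m = [D]" "fsem H scal m = \<chi> \<cdot> g \<cdot> inv_arr H \<theta>"
    by (rule wire_homE)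
  let ?m = "map_pterm Fun m"
  have map: "gwf (map_pterm Fun k) = fwf k \<and> gdom (map_pterm Fun k) = fdom k \<and> gcod (map_pterm Fun k) = fcod k" for k :: "'r fgen pterm"
    by (induction k) auto
  have "tsem ?m = Plus1 H (\<chi> \<cdot> g \<cdot> inv_arr H \<theta>)"
    using sem_functional[OF m(1)] m(4) by simp
  then have "tsem (TSeq e (TSeq ?m d)) = tsem e \<cdot> pair H (\<chi> \<cdot> g) (PrR H (osem H X) (One H))"
    using d(4) \<theta> \<chi> g by (simp add: Plus1_def osem1_def Plus1O_def)
  \<comment> \<open>The second component of the pair bypasses \<open>g\<close>: decoding sends it to
    the adjoined unit by \<open>InR\<close>, which produces exactly the summand that membership in
    \<open>hom1\<close> prescribes.\<close>
  also have "\<dots> = ((tsem e \<cdot> InL H (csem H D) (One H)) \<cdot> \<chi> \<cdot> g) \<^bold>+ ((tsem e \<cdot> InR H (csem H D) (One H)) \<cdot> PrR H (osem H X) (One H))"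
    using S_Dom[OF e(1)] e(2) \<chi> g by (simp add: pair_eq_add Comp_add osem1_def Plus1O_def)
  also have "\<dots> = f"
    using \<chi> g by (simp only: e f) simp
  finally have "tsem (TSeq e (TSeq ?m d)) = f" .
  moreover have "gwf (TSeq e (TSeq ?m d))"
    using d e m map by simp
  ultimately show ?thesis
    using TP_I[of "TSeq e (TSeq ?m d)" X Y] d e by auto
qed

end

theorem theoremG3:
  fixes H :: "('o, 'm) tp_cat"
    and scal :: "'r::{comm_semiring_0, comm_monoid_mult} \<Rightarrow> 'm"
    and X Y :: "colour list"
    and f :: "'m"
  assumes "tp_model H scal"
    and "f \<in> hom1 H (osem H X) (osem H Y)"
  shows "\<exists>d \<in> TP X Y. TP_sem H scal d = f"
  using tp_model.TP_full assms .

end
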